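(* Let $d,n\in\mathbb{N}$ and $s\in\mathbb{N}$. For every $p_{\mathbf{X}}\in\mathcal{E}[0,1]^d_n$ there exists a ReLU network $\Psi\in\mathcal{N}_{1,d}$ with connectivity $\mathcal{M}(\Psi)\le 22\cdot2^d(n^d+n^{d-1}s)$ and depth $\mathcal{L}(\Psi)=(d-1)(s+3)+2$ such that \[ W(\Psi\#U,\,p_{\mathbf{X}})\le\frac{\sqrt d}{n2^s}. \]
   Context: $\mathcal{E}[0,1]^d_n$: densities $p(\mathbf{x})=\sum_{\mathbf{k}\in\{0,\dots,n-1\}^d}w_{\mathbf{k}}\chi_{c_{\mathbf{k}}}(\mathbf{x})$ with $c_{\mathbf{k}}=\prod_{j=1}^d[i_j/n,(i_j+1)/n]$ for $\mathbf{k}=(i_1,\dots,i_d)$, all $w_{\mathbf{k}}>0$ and $\sum_{\mathbf{k}}w_{\mathbf{k}}=n^d$. A ReLU network of depth $L\ge2$ is $\Phi=W_L\circ\rho\circ W_{L-1}\circ\cdots\circ\rho\circ W_1$ with affine $W_\ell(x)=A_\ell x+b_\ell$ and $\rho(x)=\max(x,0)$ componentwise; $\mathcal{L}(\Phi)=L$; $\mathcal{M}(\Phi)$ is the total number of nonzero entries of all $A_\ell,b_\ell$; $\mathcal{N}_{d,d'}$ is the set of such networks with input dimension $d$ and output dimension $d'$. $U$ is uniform on $[0,1]$, $\#$ is push-forward, and $W$ is the 1-Wasserstein distance $W(\mu,\nu)=\inf_\pi\int|x-y|d\pi$ over couplings of $\mu,\nu$ with Euclidean norm. *)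

theory Defs
  imports "HOL-Analysis.Analysis" "HOL-Probability.Probability"
begin

text \<open>Points of R^d are extensional functions on the index set {..<d};
  the Lebesgue measure space is the product of d copies of lborel.\<close>

definition Rd :: "nat \<Rightarrow> (nat \<Rightarrow> real) measure" where
  "Rd d = PiM {..<d} (\<lambda>_. lborel)"

definition eucl_dist :: "nat \<Rightarrow> (nat \<Rightarrow> real) \<Rightarrow> (nat \<Rightarrow> real) \<Rightarrow> real" where
  "eucl_dist d x y = sqrt (\<Sum>i<d. (x i - y i)^2)"

definition couplings :: "nat \<Rightarrow> (nat \<Rightarrow> real) measure \<Rightarrow> (nat \<Rightarrow> real) measure
    \<Rightarrow> ((nat \<Rightarrow> real) \<times> (nat \<Rightarrow> real)) measure set" where
  "couplings d \<mu> \<nu> = {\<pi>. sets \<pi> = sets (Rd d \<Otimes>\<^sub>M Rd d) \<and> prob_space \<pi> \<and>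
      distr \<pi> (Rd d) fst = \<mu> \<and> distr \<pi> (Rd d) snd = \<nu>}"

definition wasserstein1 :: "nat \<Rightarrow> (nat \<Rightarrow> real) measure \<Rightarrow> (nat \<Rightarrow> real) measure \<Rightarrow> ennreal" where
  "wasserstein1 d \<mu> \<nu> =
     (INF \<pi>\<in>couplings d \<mu> \<nu>. \<integral>\<^sup>+ z. ennreal (eucl_dist d (fst z) (snd z)) \<partial>\<pi>)"

definition grid_index :: "nat \<Rightarrow> nat \<Rightarrow> (nat \<Rightarrow> nat) set" where
  "grid_index d n = PiE {..<d} (\<lambda>_. {..<n})"

definition cube :: "nat \<Rightarrow> nat \<Rightarrow> (nat \<Rightarrow> nat) \<Rightarrow> (nat \<Rightarrow> real) set" where
  "cube d n k = PiE {..<d} (\<lambda>j. {real (k j) / real n .. (real (k j) + 1) / real n})"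

definition grid_density :: "nat \<Rightarrow> nat \<Rightarrow> ((nat \<Rightarrow> nat) \<Rightarrow> real) \<Rightarrow> (nat \<Rightarrow> real) \<Rightarrow> real" where
  "grid_density d n w x = (\<Sum>k\<in>grid_index d n. w k * indicator (cube d n k) x)"

definition admissible_weights :: "nat \<Rightarrow> nat \<Rightarrow> ((nat \<Rightarrow> nat) \<Rightarrow> real) \<Rightarrow> bool" where
  "admissible_weights d n w \<longleftrightarrow>
     (\<forall>k\<in>grid_index d n. w k > 0) \<and> (\<Sum>k\<in>grid_index d n. w k) = real n ^ d"

definition grid_measure :: "nat \<Rightarrow> nat \<Rightarrow> ((nat \<Rightarrow> nat) \<Rightarrow> real) \<Rightarrow> (nat \<Rightarrow> real) measure" where
  "grid_measure d n w = density (Rd d) (\<lambda>x. ennreal (grid_density d n w x))"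

type_synonym layer = "real list list \<times> real list"

definition affine :: "layer \<Rightarrow> real list \<Rightarrow> real list" where
  "affine l x = map2 (\<lambda>row bi. sum_list (map2 (*) row x) + bi) (fst l) (snd l)"

definition relu_vec :: "real list \<Rightarrow> real list" where
  "relu_vec x = map (\<lambda>t. max t 0) x"

fun realize :: "layer list \<Rightarrow> real list \<Rightarrow> real list" where
  "realize [] x = x"
| "realize (l # ls) x = (if ls = [] then affine l x else realize ls (relu_vec (affine l x)))"

definition layer_ok :: "nat \<Rightarrow> nat \<Rightarrow> layer \<Rightarrow> bool" where
  "layer_ok m_in m_out l \<longleftrightarrow>
     length (fst l) = m_out \<and> length (snd l) = m_out \<and> (\<forall>row\<in>set (fst l). length row = m_in)"

definition relu_nets :: "nat \<Rightarrow> nat \<Rightarrow> layer list set" where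
  "relu_nets din dout = {\<Phi>. length \<Phi> \<ge> 2 \<and>
     (\<exists>ds::nat list. length ds = length \<Phi> + 1 \<and> ds ! 0 = din \<and> ds ! length \<Phi> = dout \<and>
        (\<forall>i<length \<Phi>. layer_ok (ds ! i) (ds ! Suc i) (\<Phi> ! i)))}"

definition depth :: "layer list \<Rightarrow> nat" where
  "depth \<Phi> = length \<Phi>"

definition connectivity :: "layer list \<Rightarrow> nat" where
  "connectivity \<Phi> = sum_list (map (\<lambda>l. length (filter (\<lambda>a. a \<noteq> 0) (concat (fst l)))
                                       + length (filter (\<lambda>a. a \<noteq> 0) (snd l))) \<Phi>)"

definition net_fun_1d :: "nat \<Rightarrow> layer list \<Rightarrow> real \<Rightarrow> (nat \<Rightarrow> real)" where
  "net_fun_1d d \<Phi> t = restrict (\<lambda>i. realize \<Phi> [t] ! i) {..<d}"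

definition pushforward_uniform :: "nat \<Rightarrow> layer list \<Rightarrow> (nat \<Rightarrow> real) measure" where
  "pushforward_uniform d \<Phi> = distr (uniform_measure lborel {0..1::real}) (Rd d) (net_fun_1d d \<Phi>)"

end

theory Submission
  imports Defs
begin

text \<open>If \<open>v\<close> is uniform on the unit interval and \<open>T\<close> is the tent map, then the points
  \<open>(v, T\<^sup>m v, T\<^sup>2\<^sup>m v, \<dots>)\<close> hit all \<open>2\<^sup>m\<^sup>d\<close> dyadic subcubes of side \<open>2\<^sup>-\<^sup>m\<close> with equal
  probability. One hidden layer produces, as a piecewise linear function of the input, a lower corner
  of a grid cube and a phase \<open>v\<close>: the input interval is cut into one piece per cube, of length equal
  to its mass, \<open>v\<close> runs from 0 to 1 on the initial fraction \<open>1 - \<epsilon>\<close> of the piece, and the rest serves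
  to reach the next cube continuously. Then \<open>(d - 1) m\<close> further layers, each applying \<open>T\<close> once,
  are shared by all cubes. Up to an event of probability \<open>\<epsilon>\<close>, the output hits every fine cube of side
  \<open>1 / (n 2\<^sup>m)\<close> with the correct probability, so coupling cell by cell costs at most
  \<open>\<surd>d / (n 2\<^sup>m) + \<epsilon> \<surd>d\<close>. The prescribed depth permits \<open>m = s + 3\<close>, which leaves
  room for \<open>\<epsilon> > 0\<close>.\<close>

subsection \<open>Wasserstein distance of measures agreeing on small cells\<close>

text \<open>Couple \<open>t \<in> G k\<close> with a point drawn from \<open>\<nu>\<close>
  conditioned on \<open>Q k\<close>, and the leftover \<open>t\<close>, of total mass
  \<open>\<epsilon>\<close>, with an independent point of \<open>\<nu>\<close>. The common factor
  \<open>1 - \<epsilon>\<close> in \<open>eq\<close> makes the second marginal correct: the cells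
  contribute \<open>1 - \<epsilon>\<close> times \<open>\<nu>\<close> and the leftover contributes
  \<open>\<epsilon>\<close> times \<open>\<nu>\<close>.\<close>

lemma wasserstein1_le_cells:
  fixes P :: "'a measure"
  assumes P: "prob_space P" and N: "prob_space \<nu>" and sN: "sets \<nu> = sets (Rd d)"
    and X[measurable]: "X \<in> measurable P (Rd d)" and I: "finite I"
    and dG: "disjoint_family_on G I" and G: "\<And>k. k \<in> I \<Longrightarrow> G k \<in> sets P"
    and dQ: "disjoint_family_on Q I" and Q: "\<And>k. k \<in> I \<Longrightarrow> Q k \<in> sets \<nu>"
    and cov: "AE y in \<nu>. y \<in> (\<Union>k\<in>I. Q k)"
    and pos: "\<And>k. k \<in> I \<Longrightarrow> measure \<nu> (Q k) > 0"
    and eq: "\<And>k. k \<in> I \<Longrightarrow> measure P (G k) = (1 - \<epsilon>) * measure \<nu> (Q k)"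
    and near: "\<And>k t y. k \<in> I \<Longrightarrow> t \<in> G k \<Longrightarrow> y \<in> Q k \<Longrightarrow> eucl_dist d (X t) y \<le> r"
    and far: "AE t in P. \<forall>k\<in>I. \<forall>y\<in>Q k. eucl_dist d (X t) y \<le> D"
    and eps: "0 \<le> \<epsilon>" "\<epsilon> \<le> 1" and r: "0 \<le> r" and D: "0 \<le> D"
  shows "wasserstein1 d (distr P (Rd d) X) \<nu> \<le> ennreal (r + \<epsilon> * D)"
proof -
  interpret P: prob_space P by fact
  interpret N: prob_space \<nu> by fact
  interpret pair_sigma_finite P \<nu> ..
  note [measurable_cong] = sN
  define B where "B = space P - (\<Union>k\<in>I. G k)"
  \<comment> \<open>The density of this coupling with respect to the product of \<open>P\<close> and
    \<open>\<nu>\<close>. Both marginals follow by integrating out one variable.\<close>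
  define h where "h z = (\<Sum>k\<in>I. indicator (G k) (fst z) * indicator (Q k) (snd z)
      * ennreal (1 / measure \<nu> (Q k))) + indicator B (fst z)" for z :: "'a \<times> (nat \<Rightarrow> real)"
  note [measurable] = G Q
  have Bm[measurable]: "B \<in> sets P" unfolding B_def using I G by (intro sets.Diff sets.finite_UN) auto
  have hm[measurable]: "h \<in> borel_measurable (P \<Otimes>\<^sub>M \<nu>)"
    unfolding h_def by measurable
  have sumQ: "(\<Sum>k\<in>I. measure \<nu> (Q k)) = 1"
  proof -
    have "(\<Sum>k\<in>I. measure \<nu> (Q k)) = measure \<nu> (\<Union>k\<in>I. Q k)"
      using I Q dQ by (intro N.finite_measure_finite_Union[symmetric]) auto
    also have "\<dots> = 1" using cov Q I by (subst N.prob_eq_1) auto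
    finally show ?thesis .
  qed
  have sumG: "(\<Sum>k\<in>I. measure P (G k)) = 1 - \<epsilon>"
    using sumQ by (simp add: eq sum_distrib_left[symmetric])
  have PB: "measure P B = \<epsilon>"
  proof -
    have "measure P B = 1 - measure P (\<Union>k\<in>I. G k)"
      unfolding B_def using I G by (intro P.prob_compl) auto
    also have "measure P (\<Union>k\<in>I. G k) = (\<Sum>k\<in>I. measure P (G k))"
      using I G dG by (intro P.finite_measure_finite_Union) auto
    finally show ?thesis using sumG by simp
  qed
  have part: "(\<Sum>k\<in>I. indicator (G k) t) + indicator B t = (1::ennreal)" if "t \<in> space P" for t
    using that dG I unfolding B_def
    by (subst indicator_UN_disjoint[symmetric]) (auto simp: indicator_def)
  have scale: "emeasure \<nu> (Q k) * ennreal (1 / measure \<nu> (Q k)) = 1" if "k \<in> I" for k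
    using pos[OF that] by (simp add: N.emeasure_eq_measure ennreal_mult[symmetric])
  have int1: "(\<integral>\<^sup>+y. h (t, y) \<partial>\<nu>) = 1" if "t \<in> space P" for t
  proof -
    have "(\<integral>\<^sup>+y. h (t, y) \<partial>\<nu>)
        = (\<Sum>k\<in>I. indicator (G k) t * (emeasure \<nu> (Q k) * ennreal (1 / measure \<nu> (Q k)))) + indicator B t"
      unfolding h_def
      by (simp add: nn_integral_add nn_integral_sum nn_integral_cmult nn_integral_multc Q
            mult.assoc N.emeasure_space_1)
    then show ?thesis using scale part[OF that] by simp
  qed
  have int2: "AE y in \<nu>. (\<integral>\<^sup>+t. h (t, y) \<partial>P) = 1"
    using cov
  proof (eventually_elim)
    case (elim y)
    have "(\<integral>\<^sup>+t. h (t, y) \<partial>P)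
        = (\<Sum>k\<in>I. emeasure P (G k) * (indicator (Q k) y * ennreal (1 / measure \<nu> (Q k)))) + emeasure P B"
      unfolding h_def
      by (simp add: nn_integral_add nn_integral_sum nn_integral_cmult nn_integral_multc G mult.assoc)
    also have "(\<Sum>k\<in>I. emeasure P (G k) * (indicator (Q k) y * ennreal (1 / measure \<nu> (Q k))))
        = (\<Sum>k\<in>I. ennreal (1 - \<epsilon>) * indicator (Q k) y)"
    proof (intro sum.cong refl)
      fix k assume k: "k \<in> I"
      have "emeasure P (G k) * ennreal (1 / measure \<nu> (Q k)) = ennreal (1 - \<epsilon>)"
        using pos[OF k] eps by (simp add: P.emeasure_eq_measure eq[OF k] ennreal_mult[symmetric])
      then show "emeasure P (G k) * (indicator (Q k) y * ennreal (1 / measure \<nu> (Q k)))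
         = ennreal (1 - \<epsilon>) * indicator (Q k) y"
        by (metis mult.assoc mult.commute)
    qed
    also have "\<dots> = ennreal (1 - \<epsilon>) * (\<Sum>k\<in>I. indicator (Q k) y)"
      by (simp add: sum_distrib_left)
    also have "(\<Sum>k\<in>I. indicator (Q k) y) = (1::ennreal)"
      using elim dQ I by (subst indicator_UN_disjoint[symmetric]) (auto simp: indicator_def)
    also have "ennreal (1 - \<epsilon>) * 1 + emeasure P B = 1"
      using eps by (simp add: P.emeasure_eq_measure PB ennreal_plus[symmetric] del: ennreal_plus)
    finally show ?case .
  qed
  \<comment> \<open>The coupling is first built over the parameter space of \<open>P\<close> and
    only then pushed forward along \<open>X\<close>.\<close>
  define \<pi>0 where "\<pi>0 = density (P \<Otimes>\<^sub>M \<nu>) h"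
  define \<pi> where "\<pi> = distr \<pi>0 (Rd d \<Otimes>\<^sub>M Rd d) (\<lambda>z. (X (fst z), snd z))"
  have map[measurable]: "(\<lambda>z. (X (fst z), snd z)) \<in> measurable \<pi>0 (Rd d \<Otimes>\<^sub>M Rd d)"
    unfolding \<pi>0_def by measurable
  have m1: "distr \<pi> (Rd d) fst = distr P (Rd d) X"
  proof (intro measure_eqI)
    fix A assume "A \<in> sets (distr \<pi> (Rd d) fst)"
    then have A[measurable]: "A \<in> sets (Rd d)" by simp
    have "emeasure (distr \<pi> (Rd d) fst) A = emeasure \<pi>0 ((\<lambda>z. X (fst z)) -` A \<inter> space \<pi>0)"
      unfolding \<pi>_def
      by (subst distr_distr, measurable) (simp add: comp_def, subst emeasure_distr, simp_all add: \<pi>0_def)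
    also have "\<dots> = (\<integral>\<^sup>+z. h z * indicator ((\<lambda>z. X (fst z)) -` A \<inter> space (P \<Otimes>\<^sub>M \<nu>)) z \<partial>(P \<Otimes>\<^sub>M \<nu>))"
      unfolding \<pi>0_def by (simp add: emeasure_density)
    also have "\<dots> = (\<integral>\<^sup>+z. h z * indicator A (X (fst z)) \<partial>(P \<Otimes>\<^sub>M \<nu>))"
      by (intro nn_integral_cong) (auto simp: indicator_def)
    also have "\<dots> = (\<integral>\<^sup>+t. (\<integral>\<^sup>+y. h (t, y) * indicator A (X t) \<partial>\<nu>) \<partial>P)"
      by (subst N.nn_integral_fst[symmetric]) auto
    also have "\<dots> = (\<integral>\<^sup>+t. indicator A (X t) \<partial>P)"
      by (intro nn_integral_cong) (simp add: nn_integral_multc int1)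
    also have "\<dots> = (\<integral>\<^sup>+t. indicator (X -` A \<inter> space P) t \<partial>P)"
      by (intro nn_integral_cong) (auto simp: indicator_def)
    also have "\<dots> = emeasure (distr P (Rd d) X) A" by (simp add: emeasure_distr)
    finally show "emeasure (distr \<pi> (Rd d) fst) A = emeasure (distr P (Rd d) X) A" .
  qed simp
  have m2: "distr \<pi> (Rd d) snd = \<nu>"
  proof (intro measure_eqI)
    fix A assume "A \<in> sets (distr \<pi> (Rd d) snd)"
    then have A[measurable]: "A \<in> sets (Rd d)" by simp
    have "emeasure (distr \<pi> (Rd d) snd) A = emeasure \<pi>0 (snd -` A \<inter> space \<pi>0)"
      unfolding \<pi>_def
      by (subst distr_distr, measurable) (simp add: comp_def, subst emeasure_distr, simp_all add: \<pi>0_def)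
    also have "\<dots> = (\<integral>\<^sup>+z. h z * indicator (snd -` A \<inter> space (P \<Otimes>\<^sub>M \<nu>)) z \<partial>(P \<Otimes>\<^sub>M \<nu>))"
      unfolding \<pi>0_def by (simp add: emeasure_density)
    also have "\<dots> = (\<integral>\<^sup>+z. h z * indicator A (snd z) \<partial>(P \<Otimes>\<^sub>M \<nu>))"
      by (intro nn_integral_cong) (auto simp: indicator_def)
    also have "\<dots> = (\<integral>\<^sup>+y. (\<integral>\<^sup>+t. h (t, y) * indicator A y \<partial>P) \<partial>\<nu>)"
      by (subst nn_integral_snd[symmetric]) (auto simp: case_prod_beta')
    also have "\<dots> = (\<integral>\<^sup>+y. indicator A y \<partial>\<nu>)"
      using int2 by (intro nn_integral_cong_AE) (auto elim!: eventually_mono simp: nn_integral_multc)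
    also have "\<dots> = emeasure \<nu> A" using A sN by simp
    finally show "emeasure (distr \<pi> (Rd d) snd) A = emeasure \<nu> A" .
  qed (simp add: sN)
  have prob: "prob_space \<pi>"
  proof -
    have "prob_space (distr \<pi> (Rd d) snd)" using m2 N by simp
    then show ?thesis by (rule prob_space_distrD[rotated]) (simp add: \<pi>_def)
  qed
  have [measurable]: "(\<lambda>z. eucl_dist d (fst z) (snd z)) \<in> borel_measurable (Rd d \<Otimes>\<^sub>M Rd d)"
    unfolding eucl_dist_def Rd_def by measurable
  have "(\<lambda>z. eucl_dist d (fst (X (fst z), snd z)) (snd (X (fst z), snd z))) \<in> borel_measurable \<pi>0"
    by measurable
  then have [measurable]: "(\<lambda>z. eucl_dist d (X (fst z)) (snd z)) \<in> borel_measurable (P \<Otimes>\<^sub>M \<nu>)"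
    by (simp add: \<pi>0_def)
  have "\<pi> \<in> couplings d (distr P (Rd d) X) \<nu>"
    unfolding couplings_def using m1 m2 prob by (simp add: \<pi>_def)
  then have "wasserstein1 d (distr P (Rd d) X) \<nu>
      \<le> (\<integral>\<^sup>+ z. ennreal (eucl_dist d (fst z) (snd z)) \<partial>\<pi>)"
    unfolding wasserstein1_def by (rule INF_lower)
  also have "\<dots> = (\<integral>\<^sup>+ z. h z * ennreal (eucl_dist d (X (fst z)) (snd z)) \<partial>(P \<Otimes>\<^sub>M \<nu>))"
    unfolding \<pi>_def by (subst nn_integral_distr, simp, simp) (simp add: \<pi>0_def nn_integral_density)
  also have "\<dots> = (\<integral>\<^sup>+t. (\<integral>\<^sup>+y. h (t, y) * ennreal (eucl_dist d (X t) y) \<partial>\<nu>) \<partial>P)"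
    by (subst N.nn_integral_fst[symmetric]) auto
  \<comment> \<open>Off \<open>B\<close> the density vanishes unless \<open>t\<close> and
    \<open>y\<close> lie in matching cells, which gives the bound \<open>r\<close>. On
    \<open>B\<close> the generous bound \<open>r + D\<close> suffices.\<close>
  also have "\<dots> \<le> (\<integral>\<^sup>+t. ennreal r + ennreal D * indicator B t \<partial>P)"
  proof (intro nn_integral_mono_AE)
    show "AE t in P. (\<integral>\<^sup>+y. h (t, y) * ennreal (eucl_dist d (X t) y) \<partial>\<nu>)
        \<le> ennreal r + ennreal D * indicator B t"
      using far AE_space
    proof eventually_elim
      case (elim t)
      have [measurable]: "(\<lambda>y. h (t, y)) \<in> borel_measurable \<nu>" using elim by measurable
      have "(\<integral>\<^sup>+y. h (t, y) * ennreal (eucl_dist d (X t) y) \<partial>\<nu>)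
          \<le> (\<integral>\<^sup>+y. h (t, y) * (ennreal r + ennreal D * indicator B t) \<partial>\<nu>)"
      proof (intro nn_integral_mono_AE)
        show "AE y in \<nu>. h (t, y) * ennreal (eucl_dist d (X t) y)
            \<le> h (t, y) * (ennreal r + ennreal D * indicator B t)"
          using cov
        proof eventually_elim
          case y: (elim y)
          show ?case
          proof (cases "t \<in> B")
            case True
            have "eucl_dist d (X t) y \<le> D" using y elim(1) by auto
            then have "eucl_dist d (X t) y \<le> r + D" using r by simp
            then show ?thesis using True r D
              by (intro mult_left_mono) (auto simp: ennreal_plus[symmetric] simp del: ennreal_plus
                  intro!: ennreal_leI)
          next
            case tB: False
            show ?thesis
            proof (cases "\<exists>k\<in>I. t \<in> G k \<and> y \<in> Q k")
              case True
              then show ?thesis using tB near by (auto intro!: mult_left_mono ennreal_leI)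
            next
              case False
              then have "h (t, y) = 0" using tB unfolding h_def
                by (auto simp: indicator_def intro!: sum.neutral)
              then show ?thesis by simp
            qed
          qed
        qed
      qed
      also have "\<dots> = ennreal r + ennreal D * indicator B t"
        using int1 elim by (simp add: nn_integral_multc)
      finally show ?case .
    qed
  qed
  also have "\<dots> = ennreal r + ennreal D * ennreal \<epsilon>"
    by (simp add: nn_integral_add nn_integral_cmult P.prob_space P.emeasure_eq_measure PB)
  also have "\<dots> = ennreal (r + \<epsilon> * D)"
    using r D eps by (simp add: ennreal_mult mult.commute)
  finally show ?thesis .
qed

subsection \<open>Grid measures\<close>

interpretation lborel_product: product_sigma_finite "\<lambda>_ :: nat. lborel :: real measure" ..

text \<open>The hyperplane is a product set with a null factor, and
  \<open>0 * \<infinity> = 0\<close> in \<open>ennreal\<close>.\<close>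

lemma AE_Rd_coordinate:
  assumes "j < d"
  shows "AE y in Rd d. y j \<noteq> c"
proof (rule AE_I')
  let ?S = "PiE {..<d} (\<lambda>i. if i = j then {c} else UNIV)"
  have "emeasure (Rd d) ?S = (\<Prod>i<d. emeasure lborel (if i = j then {c} else UNIV :: real set))"
    unfolding Rd_def by (intro lborel_product.emeasure_PiM) auto
  also have "\<dots> = 0" using assms by (intro prod_zero) auto
  finally show "?S \<in> null_sets (Rd d)" unfolding Rd_def by (auto intro!: sets_PiM_I_finite)
  show "{y \<in> space (Rd d). \<not> y j \<noteq> c} \<subseteq> ?S"
    using assms by (auto simp: Rd_def space_PiM PiE_iff extensional_def)
qed

text \<open>Closed grid cubes overlap along faces. Off these countably many null hyperplanes, closed
  and half-open cubes of the grid contain the same points.\<close>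

lemma AE_Rd_off_lattice: "AE y in Rd d. \<forall>j<d. \<forall>i::nat. y j \<noteq> real i / real n"
proof -
  have "AE y in Rd d. \<forall>j\<in>{..<d}. \<forall>i::nat. y j \<noteq> real i / real n"
    by (intro AE_finite_allI) (auto simp: AE_all_countable intro!: AE_Rd_coordinate)
  then show ?thesis by (auto elim!: eventually_mono)
qed

text \<open>The half-open variant of \<open>cube\<close>, chosen so that the cells of one grid are
  disjoint.\<close>

definition hcube :: "nat \<Rightarrow> nat \<Rightarrow> (nat \<Rightarrow> nat) \<Rightarrow> (nat \<Rightarrow> real) set" where
  "hcube d N k = PiE {..<d} (\<lambda>j. {real (k j) / real N ..< (real (k j) + 1) / real N})"

lemma hcube_sets [measurable]: "hcube d N k \<in> sets (Rd d)"
  unfolding hcube_def Rd_def by (intro sets_PiM_I_finite) auto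

lemma cube_sets [measurable]: "cube d N k \<in> sets (Rd d)"
  unfolding cube_def Rd_def by (intro sets_PiM_I_finite) auto

lemma emeasure_hcube: "emeasure (Rd d) (hcube d N k) = ennreal ((1 / real N) ^ d)"
proof -
  have "emeasure (Rd d) (hcube d N k)
      = (\<Prod>j<d. emeasure lborel {real (k j) / real N ..< (real (k j) + 1) / real N})"
    unfolding Rd_def hcube_def by (intro lborel_product.emeasure_PiM) auto
  also have "\<dots> = (\<Prod>j<d. ennreal (1 / real N))"
    by (intro prod.cong refl) (auto simp: add_divide_distrib)
  finally show ?thesis by (simp add: ennreal_power)
qed

lemma emeasure_cube: "emeasure (Rd d) (cube d N k) = ennreal ((1 / real N) ^ d)"
proof -
  have "emeasure (Rd d) (cube d N k)
      = (\<Prod>j<d. emeasure lborel {real (k j) / real N .. (real (k j) + 1) / real N})"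
    unfolding Rd_def cube_def by (intro lborel_product.emeasure_PiM) auto
  also have "\<dots> = (\<Prod>j<d. ennreal (1 / real N))"
    by (intro prod.cong refl) (auto simp: add_divide_distrib)
  finally show ?thesis by (simp add: ennreal_power)
qed

lemma finite_grid_index [simp]: "finite (grid_index d n)"
  unfolding grid_index_def by (intro finite_PiE) auto

lemma card_grid_index: "card (grid_index d n) = n ^ d"
  unfolding grid_index_def by (simp add: card_PiE)

text \<open>The condition \<open>0 \<le> y\<close> is there because \<open>nat\<close> sends
  negative integers to 0.\<close>

lemma mem_half_open_cell_iff:
  assumes "0 < N"
  shows "real k / real N \<le> y \<and> y < (real k + 1) / real N \<longleftrightarrow> 0 \<le> y \<and> nat \<lfloor>real N * y\<rfloor> = k"
proof -
  have "real k / real N \<le> y \<and> y < (real k + 1) / real N \<longleftrightarrow> \<lfloor>real N * y\<rfloor> = int k"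
    using assms by (simp add: floor_eq_iff divide_le_eq less_divide_eq mult.commute)
  also have "\<dots> \<longleftrightarrow> 0 \<le> real N * y \<and> nat \<lfloor>real N * y\<rfloor> = k"
    by (auto simp: nat_eq_iff) linarith
  finally show ?thesis using assms by (simp add: zero_le_mult_iff)
qed

lemma mem_hcube_iff:
  assumes "0 < N" "y \<in> extensional {..<d}"
  shows "y \<in> hcube d N k \<longleftrightarrow> (\<forall>j<d. 0 \<le> y j \<and> nat \<lfloor>real N * y j\<rfloor> = k j)"
  using assms mem_half_open_cell_iff[OF assms(1)] by (auto simp: hcube_def PiE_iff)

lemma disjoint_hcube:
  assumes "0 < N"
  shows "disjoint_family_on (hcube d N) (grid_index d N)"
  unfolding disjoint_family_on_def
proof (intro ballI impI)
  fix k k' assume k: "k \<in> grid_index d N" "k' \<in> grid_index d N" "k \<noteq> k'"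
  show "hcube d N k \<inter> hcube d N k' = {}"
  proof (rule ccontr)
    assume "hcube d N k \<inter> hcube d N k' \<noteq> {}"
    then obtain y where y: "y \<in> hcube d N k" "y \<in> hcube d N k'" by auto
    then have "y \<in> extensional {..<d}" by (auto simp: hcube_def PiE_iff)
    with y assms have "k j = k' j" if "j < d" for j using that by (auto simp: mem_hcube_iff)
    then have "k = k'" using k(1,2) by (intro PiE_ext) (auto simp: grid_index_def)
    with k show False by simp
  qed
qed

text \<open>In each coordinate the floor of \<open>n * y\<close> is the integer quotient by
  \<open>M\<close> of the floor of \<open>n * M * y\<close>, so dividing the fine index gives the
  coarse one. The hypothesis \<open>off\<close> excludes the right faces of the closed
  cubes.\<close>

lemma coarse_cube_of_fine:
  assumes "0 < n" "0 < M" "\<kappa> \<in> grid_index d (n * M)" "k \<in> grid_index d n"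
    and y: "y \<in> hcube d (n * M) \<kappa>" and off: "\<forall>j<d. \<forall>i::nat. y j \<noteq> real i / real n"
  shows "y \<in> cube d n k \<longleftrightarrow> k = (\<lambda>j\<in>{..<d}. \<kappa> j div M)"
proof -
  have ext: "y \<in> extensional {..<d}" using y by (auto simp: hcube_def PiE_iff)
  have \<kappa>: "0 \<le> y j" "nat \<lfloor>real (n * M) * y j\<rfloor> = \<kappa> j" if "j < d" for j
    using y ext that assms by (auto simp: mem_hcube_iff)
  have div: "nat \<lfloor>real n * y j\<rfloor> = \<kappa> j div M" if "j < d" for j
  proof -
    have "real n * y j = real (n * M) * y j / real M" using assms by simp
    then have "\<lfloor>real n * y j\<rfloor> = \<lfloor>real (n * M) * y j\<rfloor> div int M"
      using floor_divide_real_eq_div[of "int M" "real (n * M) * y j"] by simp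
    then show ?thesis using \<kappa>[OF that] by (simp add: nat_div_distrib)
  qed
  have "y \<in> cube d n k \<longleftrightarrow> y \<in> hcube d n k"
  proof -
    have "y j \<le> (real (k j) + 1) / real n \<longleftrightarrow> y j < (real (k j) + 1) / real n" if "j < d" for j
      using off[rule_format, OF that, of "Suc (k j)"] by (auto simp: add.commute)
    then show ?thesis by (auto simp: cube_def hcube_def PiE_iff)
  qed
  also have "\<dots> \<longleftrightarrow> (\<forall>j<d. \<kappa> j div M = k j)"
    using \<kappa>(1) div assms ext by (auto simp: mem_hcube_iff)
  also have "\<dots> \<longleftrightarrow> k = (\<lambda>j\<in>{..<d}. \<kappa> j div M)"
    using assms(4) by (auto simp: grid_index_def PiE_iff extensional_def fun_eq_iff)
  finally show ?thesis .
qed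

lemma coarse_index: "\<kappa> \<in> grid_index d (n * M) \<Longrightarrow> (\<lambda>j\<in>{..<d}. \<kappa> j div M) \<in> grid_index d n"
  by (auto simp: grid_index_def PiE_iff less_mult_imp_div_less)

lemma grid_density_measurable [measurable]: "grid_density d n w \<in> borel_measurable (Rd d)"
  unfolding grid_density_def[abs_def] by measurable

lemma emeasure_grid_measure_hcube:
  assumes "0 < n" "0 < M" "admissible_weights d n w" "\<kappa> \<in> grid_index d (n * M)"
  shows "emeasure (grid_measure d n w) (hcube d (n * M) \<kappa>)
      = ennreal (w (\<lambda>j\<in>{..<d}. \<kappa> j div M) / real (n * M) ^ d)"
proof -
  let ?k = "\<lambda>j\<in>{..<d}. \<kappa> j div M"
  have k: "?k \<in> grid_index d n" by (rule coarse_index) fact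
  have "emeasure (grid_measure d n w) (hcube d (n * M) \<kappa>)
      = (\<integral>\<^sup>+y. ennreal (grid_density d n w y) * indicator (hcube d (n * M) \<kappa>) y \<partial>Rd d)"
    unfolding grid_measure_def by (simp add: emeasure_density)
  also have "\<dots> = (\<integral>\<^sup>+y. ennreal (w ?k) * indicator (hcube d (n * M) \<kappa>) y \<partial>Rd d)"
  proof (rule nn_integral_cong_AE, rule AE_mp[OF AE_Rd_off_lattice[of d n]], intro AE_I2 impI)
    fix y assume elim: "\<forall>j<d. \<forall>i::nat. y j \<noteq> real i / real n"
    show "ennreal (grid_density d n w y) * indicator (hcube d (n * M) \<kappa>) y
        = ennreal (w ?k) * indicator (hcube d (n * M) \<kappa>) y"
    proof (cases "y \<in> hcube d (n * M) \<kappa>")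
      case True
      have "grid_density d n w y = (\<Sum>k\<in>grid_index d n. if k = ?k then w ?k else 0)"
        unfolding grid_density_def
      proof (intro sum.cong refl)
        fix k assume "k \<in> grid_index d n"
        then have "y \<in> cube d n k \<longleftrightarrow> k = ?k"
          by (rule coarse_cube_of_fine[OF assms(1,2,4) _ True elim])
        then show "w k * indicator (cube d n k) y = (if k = ?k then w ?k else 0)"
          by (cases "k = ?k") simp_all
      qed
      then show ?thesis using k by simp
    qed simp
  qed
  also have "\<dots> = ennreal (w ?k) * ennreal ((1 / real (n * M)) ^ d)"
    by (simp add: nn_integral_cmult emeasure_hcube)
  also have "\<dots> = ennreal (w ?k / real (n * M) ^ d)"
    using assms(3) k unfolding admissible_weights_def
    by (subst ennreal_mult[symmetric]) (auto simp: power_divide less_imp_le)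
  finally show ?thesis .
qed

text \<open>Overlapping faces do no harm, since the integral of the sum is taken term by
  term.\<close>

lemma prob_space_grid_measure:
  assumes "0 < n" "admissible_weights d n w"
  shows "prob_space (grid_measure d n w)"
proof
  have w: "k \<in> grid_index d n \<Longrightarrow> 0 \<le> w k" for k
    using assms(2) by (auto simp: admissible_weights_def less_imp_le)
  have "emeasure (grid_measure d n w) (space (grid_measure d n w))
      = (\<integral>\<^sup>+y. ennreal (grid_density d n w y) \<partial>Rd d)"
    unfolding grid_measure_def by (simp add: emeasure_density)
  also have "\<dots> = (\<integral>\<^sup>+y. (\<Sum>k\<in>grid_index d n. ennreal (w k) * indicator (cube d n k) y) \<partial>Rd d)"
    unfolding grid_density_def using w
    by (intro nn_integral_cong, subst sum_ennreal[symmetric])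
      (auto simp: ennreal_mult' ennreal_indicator)
  also have "\<dots> = (\<Sum>k\<in>grid_index d n. ennreal (w k) * ennreal ((1 / real n) ^ d))"
    by (subst nn_integral_sum) (simp_all add: nn_integral_cmult emeasure_cube)
  also have "\<dots> = (\<Sum>k\<in>grid_index d n. ennreal (w k * (1 / real n) ^ d))"
    using w by (intro sum.cong refl) (simp add: ennreal_mult)
  also have "\<dots> = ennreal ((\<Sum>k\<in>grid_index d n. w k) * (1 / real n) ^ d)"
    using w by (subst sum_ennreal) (auto simp: sum_distrib_right)
  also have "\<dots> = 1" using assms by (simp add: admissible_weights_def power_divide)
  finally show "emeasure (grid_measure d n w) (space (grid_measure d n w)) = 1" .
qed

lemma AE_grid_measure_hcube:
  assumes "0 < n" "0 < M"
  shows "AE y in grid_measure d n w. y \<in> (\<Union>\<kappa>\<in>grid_index d (n * M). hcube d (n * M) \<kappa>)"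
proof -
  have "AE y in Rd d. 0 < ennreal (grid_density d n w y) \<longrightarrow>
      y \<in> (\<Union>\<kappa>\<in>grid_index d (n * M). hcube d (n * M) \<kappa>)"
    using AE_Rd_off_lattice[of d n]
  proof eventually_elim
    case (elim y)
    show ?case
    proof
      assume "0 < ennreal (grid_density d n w y)"
      then have "grid_density d n w y \<noteq> 0" by auto
      then obtain k where k: "k \<in> grid_index d n" "y \<in> cube d n k"
        unfolding grid_density_def by (metis (no_types, lifting) indicator_simps(2) mult_zero_right sum.neutral)
      have y: "0 \<le> y j" "y j < 1" if "j < d" for j
      proof -
        have b: "real (k j) / real n \<le> y j" "y j \<le> (real (k j) + 1) / real n"
          using k that by (auto simp: cube_def PiE_iff)
        show "0 \<le> y j" using b(1) order_trans[of 0 "real (k j) / real n" "y j"] by simp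
        have "k j < n" using k that by (auto simp: grid_index_def PiE_iff)
        then have "(real (k j) + 1) / real n \<le> 1" by simp
        \<comment> \<open>The value 1 is the lattice point \<open>n / n\<close>, hence excluded by
          \<open>elim\<close>.\<close>
        moreover have "y j \<noteq> 1" using elim that assms by (metis divide_self of_nat_0_eq_iff less_irrefl)
        ultimately show "y j < 1" using b by simp
      qed
      let ?\<kappa> = "\<lambda>j\<in>{..<d}. nat \<lfloor>real (n * M) * y j\<rfloor>"
      have "y \<in> extensional {..<d}" using k by (auto simp: cube_def PiE_iff)
      then have "y \<in> hcube d (n * M) ?\<kappa>" using y assms by (subst mem_hcube_iff) auto
      moreover have "?\<kappa> \<in> grid_index d (n * M)"
      proof -
        have "nat \<lfloor>real (n * M) * y j\<rfloor> < n * M" if "j < d" for j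
        proof -
          have "real (n * M) * y j < real (n * M) * 1"
            using y[OF that] assms by (intro mult_strict_left_mono) auto
          then have "\<lfloor>real (n * M) * y j\<rfloor> < int (n * M)" by (simp add: floor_less_iff)
          then show ?thesis using assms by (subst nat_less_iff) (use y[OF that] in auto)
        qed
        then show ?thesis by (auto simp: grid_index_def)
      qed
      ultimately show "y \<in> (\<Union>\<kappa>\<in>grid_index d (n * M). hcube d (n * M) \<kappa>)" by blast
    qed
  qed
  then show ?thesis unfolding grid_measure_def by (subst AE_density) auto
qed

subsection \<open>Iterated tent maps\<close>

text \<open>On the unit interval this is the tent map with peak at 1/2, written with two rectifiers
  so that one layer can evaluate it.\<close>

definition tent :: "real \<Rightarrow> real" where
  "tent v = 2 * max v 0 - 4 * max (v - 1/2) 0"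

lemma tent_range: "0 \<le> v \<Longrightarrow> v \<le> 1 \<Longrightarrow> 0 \<le> tent v \<and> tent v \<le> 1"
  by (auto simp: tent_def max_def)

lemma funpow_tent_range: "0 \<le> v \<Longrightarrow> v \<le> 1 \<Longrightarrow> 0 \<le> (tent ^^ k) v \<and> (tent ^^ k) v \<le> 1"
  by (induction k) (auto simp: tent_range)

text \<open>Split off the last binary digit of \<open>h\<close>: the first \<open>m\<close>
  iterations unfold the longer interval with index \<open>h div 2\<close>, and the outermost
  \<open>tent\<close> resolves the half in which the point lies.\<close>

lemma funpow_tent:
  assumes "0 \<le> \<rho>" "\<rho> \<le> 1"
  shows "h < 2 ^ m \<Longrightarrow> (tent ^^ m) ((real h + \<rho>) / 2 ^ m) = (if even h then \<rho> else 1 - \<rho>)"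
  using assms
proof (induction m arbitrary: h \<rho>)
  case 0
  then show ?case by simp
next
  case (Suc m)
  define g e where "g = h div 2" and "e = h mod 2"
  have h: "h = 2 * g + e" and e: "e = 0 \<or> e = 1" by (auto simp: g_def e_def)
  have "(real h + \<rho>) / 2 ^ Suc m = (real g + (real e + \<rho>) / 2) / 2 ^ m"
    by (simp add: h field_simps)
  moreover have "(tent ^^ m) \<dots> = (if even g then (real e + \<rho>) / 2 else 1 - (real e + \<rho>) / 2)"
    using Suc.prems e h by (intro Suc.IH) auto
  ultimately have "(tent ^^ Suc m) ((real h + \<rho>) / 2 ^ Suc m)
      = tent (if even g then (real e + \<rho>) / 2 else 1 - (real e + \<rho>) / 2)" by simp
  \<comment> \<open>The symmetry \<open>tent (1 - x) = tent x\<close> on the unit interval removes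
    the dependence on the parity of \<open>g\<close>.\<close>
  also have "\<dots> = (if e = 0 then \<rho> else 1 - \<rho>)"
    using Suc.prems e by (auto simp: tent_def max_def field_simps)
  also have "e = 0 \<longleftrightarrow> even h" using e h by auto
  finally show ?case .
qed

text \<open>\<open>snake M d \<kappa>\<close> is the position of the digit vector \<open>\<kappa> \<in> {0..<M}\<^sup>d\<close> in boustrophedon order.
  Folding an interval of length \<open>1 / M\<close> onto the unit interval reverses its orientation when its index is odd.\<close>

fun snake :: "nat \<Rightarrow> nat \<Rightarrow> (nat \<Rightarrow> nat) \<Rightarrow> nat" where
  "snake M 0 \<kappa> = 0"
| "snake M (Suc d) \<kappa> = \<kappa> 0 * M ^ d +
     (if even (\<kappa> 0) then snake M d (\<kappa> \<circ> Suc) else M ^ d - 1 - snake M d (\<kappa> \<circ> Suc))"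

lemma snake_less: "(\<And>j. j < d \<Longrightarrow> \<kappa> j < M) \<Longrightarrow> snake M d \<kappa> < M ^ d"
proof (induction d arbitrary: \<kappa>)
  case (Suc d)
  have "snake M d (\<kappa> \<circ> Suc) < M ^ d" using Suc.prems by (intro Suc.IH) auto
  then have "snake M (Suc d) \<kappa> < (\<kappa> 0 + 1) * M ^ d" by auto
  also have "\<dots> \<le> M * M ^ d" using Suc.prems[of 0] by (intro mult_right_mono) auto
  finally show ?case by simp
qed simp

text \<open>The tail, reflected or not, is below \<open>M ^ d\<close>, so division by
  \<open>M ^ d\<close> recovers the leading digit. Its parity tells whether the tail was reflected,
  and induction treats the tail.\<close>

lemma snake_inject:
  assumes "snake M d \<kappa> = snake M d \<kappa>'" "\<And>j. j < d \<Longrightarrow> \<kappa> j < M" "\<And>j. j < d \<Longrightarrow> \<kappa>' j < M" "j < d"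
  shows "\<kappa> j = \<kappa>' j"
  using assms
proof (induction d arbitrary: \<kappa> \<kappa>' j)
  case (Suc d)
  define r where "r \<kappa> = (if even (\<kappa> 0) then snake M d (\<kappa> \<circ> Suc) else M ^ d - 1 - snake M d (\<kappa> \<circ> Suc))"
    for \<kappa>
  have l: "snake M d (\<kappa> \<circ> Suc) < M ^ d" "snake M d (\<kappa>' \<circ> Suc) < M ^ d"
    using Suc.prems by (auto intro!: snake_less)
  then have r: "r \<kappa> < M ^ d" "r \<kappa>' < M ^ d" by (auto simp: r_def)
  have e: "\<kappa> 0 * M ^ d + r \<kappa> = \<kappa>' 0 * M ^ d + r \<kappa>'" using Suc.prems(1) by (simp add: r_def)
  have 0: "\<kappa> 0 = \<kappa>' 0"
  proof -
    have "(\<kappa> 0 * M ^ d + r \<kappa>) div M ^ d = \<kappa> 0" "(\<kappa>' 0 * M ^ d + r \<kappa>') div M ^ d = \<kappa>' 0"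
      using r by (simp_all only: div_mult_self3 div_less)
    then show ?thesis using e by simp
  qed
  then have "r \<kappa> = r \<kappa>'" using e by simp
  then have "snake M d (\<kappa> \<circ> Suc) = snake M d (\<kappa>' \<circ> Suc)"
    using 0 l by (auto simp: r_def split: if_splits)
  then have "i < d \<Longrightarrow> (\<kappa> \<circ> Suc) i = (\<kappa>' \<circ> Suc) i" for i
    using Suc.IH[of "\<kappa> \<circ> Suc" "\<kappa>' \<circ> Suc" i] Suc.prems(2,3) by (auto simp: comp_def)
  then show ?case using 0 Suc.prems(4) by (cases j) auto
qed simp

text \<open>Applying \<open>tent\<close> \<open>m\<close> times consumes the leading digit and
  reverses orientation exactly when that digit is odd. This cancels the reflection in
  \<open>snake\<close>, so the image lies in the interval belonging to the remaining digits. Both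
  bounds are closed because a reversal exchanges the endpoints.\<close>

lemma funpow_tent_snake:
  assumes "\<And>j. j < d \<Longrightarrow> \<kappa> j < 2 ^ m" "j < d"
    and "real (snake (2 ^ m) d \<kappa>) / (2 ^ m) ^ d \<le> u" "u \<le> (real (snake (2 ^ m) d \<kappa>) + 1) / (2 ^ m) ^ d"
  shows "real (\<kappa> j) / 2 ^ m \<le> (tent ^^ (m * j)) u \<and> (tent ^^ (m * j)) u \<le> (real (\<kappa> j) + 1) / 2 ^ m"
  using assms
proof (induction d arbitrary: \<kappa> j u)
  case (Suc d)
  define M :: real where "M = 2 ^ m"
  define C where "C = M ^ d"
  define c where "c = snake (2 ^ m) d (\<kappa> \<circ> Suc)"
  have pos: "M > 0" "C > 0" by (auto simp: M_def C_def)
  have "c < (2 ^ m) ^ d" unfolding c_def using Suc.prems by (auto intro!: snake_less)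
  then have c: "real c + 1 \<le> C" "c + 1 \<le> (2 ^ m) ^ d"
    using of_nat_le_iff[of "c + 1" "(2 ^ m) ^ d", where 'a = real] by (auto simp: C_def M_def)
  \<comment> \<open>The relative position of \<open>u\<close> inside the interval of its leading
    digit.\<close>
  define \<rho> where "\<rho> = u * M - real (\<kappa> 0)"
  \<comment> \<open>The tail of the snake position as a real number; \<open>c + 1 \<le> C\<close>
    ensures that the truncated subtraction in \<open>snake\<close> agrees with it.\<close>
  define r where "r = (if even (\<kappa> 0) then real c else C - 1 - real c)"
  have sn: "real (snake (2 ^ m) (Suc d) \<kappa>) = real (\<kappa> 0) * C + r"
    using c by (auto simp: c_def[symmetric] r_def C_def M_def of_nat_diff)
  have pw: "(2 ^ m) ^ Suc d = M * C" by (simp add: M_def C_def)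
  have "real (\<kappa> 0) * C + r \<le> u * (M * C)" "u * (M * C) \<le> real (\<kappa> 0) * C + r + 1"
    using Suc.prems(3,4) pos unfolding sn pw by (auto simp: divide_le_eq le_divide_eq)
  then have "r \<le> \<rho> * C" "\<rho> * C \<le> r + 1" by (auto simp: \<rho>_def algebra_simps)
  then have \<rho>: "r / C \<le> \<rho>" "\<rho> \<le> (r + 1) / C" using pos by (auto simp: divide_le_eq le_divide_eq)
  have "0 \<le> r / C" "(r + 1) / C \<le> 1" using c pos by (auto simp: r_def)
  then have \<rho>01: "0 \<le> \<rho>" "\<rho> \<le> 1" using \<rho> by linarith+
  have u: "u = (real (\<kappa> 0) + \<rho>) / 2 ^ m" by (simp add: \<rho>_def M_def)
  have T: "(tent ^^ m) u = (if even (\<kappa> 0) then \<rho> else 1 - \<rho>)"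
    unfolding u using \<rho>01 Suc.prems(1)[of 0] by (intro funpow_tent) auto
  \<comment> \<open>In the odd case \<open>r = C - 1 - c\<close>, and passing to
    \<open>1 - \<rho>\<close> undoes this reflection.\<close>
  have T': "real c / C \<le> (tent ^^ m) u" "(tent ^^ m) u \<le> (real c + 1) / C"
    using \<rho> pos unfolding T r_def by (auto simp: field_simps split: if_splits)
  show ?case
  proof (cases j)
    case 0
    then show ?thesis using u \<rho>01 by (simp add: divide_right_mono)
  next
    case (Suc i)
    have "real ((\<kappa> \<circ> Suc) i) / 2 ^ m \<le> (tent ^^ (m * i)) ((tent ^^ m) u) \<and>
        (tent ^^ (m * i)) ((tent ^^ m) u) \<le> (real ((\<kappa> \<circ> Suc) i) + 1) / 2 ^ m"
    proof (rule Suc.IH)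
      show "(\<kappa> \<circ> Suc) j' < 2 ^ m" if "j' < d" for j' using Suc.prems(1) that by simp
      show "i < d" using Suc.prems(2) Suc by simp
    qed (use T' in \<open>simp_all only: c_def C_def M_def\<close>)
    moreover have "m * Suc i = m * i + m" by simp
    ultimately show ?thesis unfolding Suc by (simp only: funpow_add comp_apply)
  qed
qed simp

subsection \<open>Piecewise linear interpolation by one hidden layer\<close>

definition slope :: "(nat \<Rightarrow> real) \<Rightarrow> (nat \<Rightarrow> real) \<Rightarrow> nat \<Rightarrow> real" where
  "slope y \<tau> j = (y (Suc j) - y j) / (\<tau> (Suc j) - \<tau> j)"

text \<open>The jump of the slope at a knot, which is the coefficient of the rectified
  \<open>t - \<tau> j\<close> in the interpolant. To the left of the first knot the slope counts as
  0.\<close>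

definition kink :: "(nat \<Rightarrow> real) \<Rightarrow> (nat \<Rightarrow> real) \<Rightarrow> nat \<Rightarrow> real" where
  "kink y \<tau> j = (case j of 0 \<Rightarrow> slope y \<tau> 0 | Suc i \<Rightarrow> slope y \<tau> (Suc i) - slope y \<tau> i)"

text \<open>The slopes telescope, and consecutive affine pieces agree at their common knot.\<close>

lemma sum_kink:
  assumes "\<And>j. j < K \<Longrightarrow> \<tau> j < \<tau> (Suc j)" "r < K"
  shows "y 0 + (\<Sum>j\<le>r. kink y \<tau> j * (t - \<tau> j)) = y r + slope y \<tau> r * (t - \<tau> r)"
  using assms(2)
proof (induction r)
  case (Suc r)
  have "slope y \<tau> r * (\<tau> (Suc r) - \<tau> r) = y (Suc r) - y r"
    using assms(1)[of r] Suc.prems by (simp add: slope_def)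
  then show ?case using Suc by (simp add: kink_def algebra_simps)
qed (simp add: kink_def)

text \<open>On the interval number \<open>r\<close> the rectifiers of later knots vanish and the
  others are affine, which reduces the claim to \<open>sum_kink\<close>.\<close>

lemma relu_interpolation:
  assumes \<tau>: "\<And>j. j < K \<Longrightarrow> \<tau> j < \<tau> (Suc j)" and r: "r < K" and t: "\<tau> r \<le> t" "t \<le> \<tau> (Suc r)"
  shows "(\<Sum>j<K. kink y \<tau> j * max (t - \<tau> j) 0) + y 0
      = y r + (y (Suc r) - y r) * ((t - \<tau> r) / (\<tau> (Suc r) - \<tau> r))"
proof -
  have mono: "\<tau> i \<le> \<tau> j" if "i \<le> j" "j \<le> K" for i j
    using that
  proof (induction j rule: dec_induct)
    case (step j)
    then show ?case using \<tau>[of j] by simp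
  qed simp
  have "(\<Sum>j<K. kink y \<tau> j * max (t - \<tau> j) 0) = (\<Sum>j\<le>r. kink y \<tau> j * max (t - \<tau> j) 0)"
  proof (intro sum.mono_neutral_right)
    show "\<forall>i\<in>{..<K} - {..r}. kink y \<tau> i * max (t - \<tau> i) 0 = 0"
    proof
      fix i assume "i \<in> {..<K} - {..r}"
      then have "t \<le> \<tau> i" using t mono[of "Suc r" i] by auto
      then show "kink y \<tau> i * max (t - \<tau> i) 0 = 0" by simp
    qed
  qed (use r in auto)
  also have "\<dots> = (\<Sum>j\<le>r. kink y \<tau> j * (t - \<tau> j))"
  proof (intro sum.cong refl)
    fix j assume "j \<in> {..r}"
    then have "\<tau> j \<le> t" using mono[of j r] t r by simp
    then show "kink y \<tau> j * max (t - \<tau> j) 0 = kink y \<tau> j * (t - \<tau> j)" by simp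
  qed
  finally show ?thesis using sum_kink[of K \<tau> r y t] \<tau> r by (simp add: slope_def)
qed

subsection \<open>Networks given by weight functions\<close>

definition mk_layer :: "nat \<Rightarrow> nat \<Rightarrow> (nat \<Rightarrow> nat \<Rightarrow> real) \<Rightarrow> (nat \<Rightarrow> real) \<Rightarrow> layer" where
  "mk_layer m_out m_in A b = (map (\<lambda>i. map (A i) [0..<m_in]) [0..<m_out], map b [0..<m_out])"

lemma sum_list_map2_mult: "sum_list (map2 (*) (map f xs) (map g xs)) = (\<Sum>x\<leftarrow>xs. f x * g x)"
  by (induction xs) auto

lemma affine_mk_layer:
  "affine (mk_layer m_out m_in A b) (map x [0..<m_in])
     = map (\<lambda>i. (\<Sum>j<m_in. A i j * x j) + b i) [0..<m_out]"
  by (rule nth_equalityI)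
    (auto simp: affine_def mk_layer_def sum_list_map2_mult interv_sum_list_conv_sum_set_nat
      atLeast0LessThan)

lemma layer_ok_mk_layer: "layer_ok m_in m_out (mk_layer m_out m_in A b)"
  by (auto simp: layer_ok_def mk_layer_def)

text \<open>Weights given as functions turn evaluation and counting of entries into finite sums. The
  affine map number \<open>l\<close> goes from dimension \<open>sz l\<close> to
  \<open>sz (Suc l)\<close>.\<close>

definition net :: "nat \<Rightarrow> (nat \<Rightarrow> nat) \<Rightarrow> (nat \<Rightarrow> nat \<Rightarrow> nat \<Rightarrow> real) \<Rightarrow> (nat \<Rightarrow> nat \<Rightarrow> real) \<Rightarrow> layer list" where
  "net L sz A b = map (\<lambda>l. mk_layer (sz (Suc l)) (sz l) (A l) (b l)) [0..<L]"

text \<open>Values are recorded before rectification because the last affine map is not followed by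
  one.\<close>

fun preact :: "(nat \<Rightarrow> nat) \<Rightarrow> (nat \<Rightarrow> nat \<Rightarrow> nat \<Rightarrow> real) \<Rightarrow> (nat \<Rightarrow> nat \<Rightarrow> real)
    \<Rightarrow> (nat \<Rightarrow> real) \<Rightarrow> nat \<Rightarrow> nat \<Rightarrow> real" where
  "preact sz A b x 0 i = (\<Sum>j<sz 0. A 0 i j * x j) + b 0 i"
| "preact sz A b x (Suc l) i
     = (\<Sum>j<sz (Suc l). A (Suc l) i j * max (preact sz A b x l j) 0) + b (Suc l) i"

text \<open>Starting at an arbitrary layer allows induction on the number of remaining layers;
  \<open>k + 1\<close> of them remain, so the list is never empty.\<close>

lemma realize_net_from:
  "realize (map (\<lambda>l. mk_layer (sz (Suc l)) (sz l) (A l) (b l)) [Suc l..<Suc (Suc (l + k))])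
       (relu_vec (map (preact sz A b x l) [0..<sz (Suc l)]))
     = map (preact sz A b x (Suc (l + k))) [0..<sz (Suc (Suc (l + k)))]"
proof (induction k arbitrary: l)
  case 0
  show ?case by (simp add: relu_vec_def comp_def affine_mk_layer)
next
  case (Suc k)
  have u: "[Suc l..<Suc (Suc (l + Suc k))] = Suc l # [Suc (Suc l)..<Suc (Suc (Suc l + k))]"
    by (subst upt_conv_Cons) simp_all
  have "affine (mk_layer (sz (Suc (Suc l))) (sz (Suc l)) (A (Suc l)) (b (Suc l)))
      (relu_vec (map (preact sz A b x l) [0..<sz (Suc l)]))
      = map (preact sz A b x (Suc l)) [0..<sz (Suc (Suc l))]"
    by (simp add: relu_vec_def comp_def affine_mk_layer)
  moreover have "[Suc (Suc l)..<Suc (Suc (Suc l + k))] \<noteq> []" by simp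
  ultimately show ?case using Suc.IH[of "Suc l"]
    unfolding u by (simp del: upt_Suc preact.simps)
qed

lemma realize_net:
  "realize (net (Suc (Suc k)) sz A b) (map x [0..<sz 0])
     = map (preact sz A b x (Suc k)) [0..<sz (Suc (Suc k))]"
proof -
  have u: "[0..<Suc (Suc k)] = 0 # [Suc 0..<Suc (Suc (0 + k))]"
    by (subst upt_conv_Cons) simp_all
  have "affine (mk_layer (sz (Suc 0)) (sz 0) (A 0) (b 0)) (map x [0..<sz 0])
      = map (preact sz A b x 0) [0..<sz (Suc 0)]"
    by (simp add: affine_mk_layer)
  then show ?thesis using realize_net_from[of sz A b 0 k x]
    unfolding net_def u by (simp del: upt_Suc preact.simps)
qed

lemma net_in_relu_nets:
  assumes "2 \<le> L"
  shows "net L sz A b \<in> relu_nets (sz 0) (sz L)"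
proof -
  let ?ds = "map sz [0..<Suc L]"
  have "length ?ds = length (net L sz A b) + 1 \<and> ?ds ! 0 = sz 0 \<and> ?ds ! length (net L sz A b) = sz L \<and>
        (\<forall>i<length (net L sz A b). layer_ok (?ds ! i) (?ds ! Suc i) (net L sz A b ! i))"
    by (auto simp: net_def layer_ok_mk_layer nth_append simp del: upt_Suc)
  then show ?thesis using assms unfolding relu_nets_def
    by (intro CollectI conjI exI[of _ ?ds]) (auto simp: net_def)
qed

lemma length_filter_upt: "length (filter P [0..<k]) = card {j. j < k \<and> P j}"
proof -
  have "length (filter P [0..<k]) = card (set (filter P [0..<k]))"
    by (intro distinct_card[symmetric]) simp
  also have "set (filter P [0..<k]) = {j. j < k \<and> P j}" by auto
  finally show ?thesis .
qed

text \<open>\<open>N l\<close> bounds the nonzero weights in a row, and the added 1 pays for the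
  bias.\<close>

lemma connectivity_net_le:
  assumes "\<And>l i. l < L \<Longrightarrow> i < sz (Suc l) \<Longrightarrow> card {j. j < sz l \<and> A l i j \<noteq> 0} \<le> N l"
  shows "connectivity (net L sz A b) \<le> (\<Sum>l<L. sz (Suc l) * (N l + 1))"
proof -
  define c where "c l = length (filter (\<lambda>a. a \<noteq> 0) (concat (fst (l :: layer))))
       + length (filter (\<lambda>a. a \<noteq> 0) (snd l))" for l
  have "connectivity (net L sz A b) = (\<Sum>l<L. c (mk_layer (sz (Suc l)) (sz l) (A l) (b l)))"
    by (simp add: connectivity_def net_def c_def[abs_def] comp_def interv_sum_list_conv_sum_set_nat
        atLeast0LessThan)
  also have "\<dots> \<le> (\<Sum>l<L. sz (Suc l) * (N l + 1))"
  proof (intro sum_mono)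
    fix l assume l: "l \<in> {..<L}"
    have "length (filter (\<lambda>a. a \<noteq> 0) (concat (fst (mk_layer (sz (Suc l)) (sz l) (A l) (b l)))))
        = (\<Sum>i<sz (Suc l). card {j. j < sz l \<and> A l i j \<noteq> 0})"
      by (simp add: mk_layer_def filter_concat length_concat comp_def length_filter_upt
          interv_sum_list_conv_sum_set_nat atLeast0LessThan)
    also have "\<dots> \<le> sz (Suc l) * N l"
      using sum_mono[of "{..<sz (Suc l)}" _ "\<lambda>_. N l"] assms l by simp
    finally have 1: "length (filter (\<lambda>a. a \<noteq> 0) (concat (fst (mk_layer (sz (Suc l)) (sz l) (A l) (b l)))))
        \<le> sz (Suc l) * N l" .
    have "length (filter (\<lambda>a. a \<noteq> 0) (snd (mk_layer (sz (Suc l)) (sz l) (A l) (b l)))) \<le> sz (Suc l)"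
      using length_filter_le[of "\<lambda>a. a \<noteq> 0" "map (b l) [0..<sz (Suc l)]"] by (simp add: mk_layer_def)
    with 1 show "c (mk_layer (sz (Suc l)) (sz l) (A l) (b l)) \<le> sz (Suc l) * (N l + 1)"
      by (simp add: c_def)
  qed
  finally show ?thesis .
qed

subsection \<open>The generating curve\<close>

text \<open>\<open>e\<close> fixes the order in which the curve visits the cubes, \<open>m\<close>
  is the number of tent layers per coordinate, and \<open>\<epsilon>\<close> is the fraction of each
  piece spent on moving to the next cube.\<close>

locale grid_net =
  fixes d n m :: nat and w :: "(nat \<Rightarrow> nat) \<Rightarrow> real" and e :: "nat \<Rightarrow> nat \<Rightarrow> nat" and \<epsilon> :: real
  assumes d: "1 \<le> d" and n: "1 \<le> n" and m: "1 \<le> m"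
    and weights: "admissible_weights d n w"
    and enum: "bij_betw e {..<n ^ d} (grid_index d n)"
    and eps: "0 < \<epsilon>" "\<epsilon> < 1"
begin

definition mass :: "nat \<Rightarrow> real" where "mass i = w (e i) / real n ^ d"

definition knot :: "nat \<Rightarrow> real" where
  "knot r = (\<Sum>i<r div 2. mass i) + (if odd r then (1 - \<epsilon>) * mass (r div 2) else 0)"

text \<open>On \<open>[knot (2 * i), knot (2 * i + 1)]\<close> the curve runs through the cube \<open>e i\<close>;
  on the short interval \<open>[knot (2 * i + 1), knot (2 * i + 2)]\<close> it moves on to the next cube.
  The truncation by \<open>n ^ d - 1\<close> only concerns the last knot.\<close>

definition corner :: "nat \<Rightarrow> nat \<Rightarrow> real" where
  "corner i r = real (e (min (r div 2) (n ^ d - 1)) i) / real n"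

text \<open>Interpolated, this rises from 0 to 1 while a cube is traversed and falls back during the
  transition.\<close>

definition phase :: "nat \<Rightarrow> real" where "phase r = real (r mod 2)"

text \<open>Coordinate 0 needs no tent iteration and receives the phase at once. Both indices
  \<open>d\<close> and \<open>d + 1\<close> carry the phase; the shift by 1/2 is left to
  \<open>bias\<close>.\<close>

definition value_at :: "nat \<Rightarrow> nat \<Rightarrow> real" where
  "value_at i r = (if i < d then corner i r + (if i = 0 then phase r / real n else 0) else phase r)"

definition steps :: nat where "steps = (d - 1) * m"

text \<open>The hidden layer has one neuron per interval between knots. The last affine map drops
  the two phase entries.\<close>

definition width :: "nat \<Rightarrow> nat" where
  "width l = (if l = 0 then 1 else if l = 1 then 2 * n ^ d else if l = steps + 2 then d else d + 2)"

text \<open>From layer 1 on, the state consists of the \<open>d\<close> output coordinates under construction, the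
  phase \<open>v\<close>, and \<open>v - 1 / 2\<close>; after rectification the last two yield \<open>tent v\<close>. Layer \<open>m * i + 1\<close>
  adds the current phase to the \<open>i\<close>-th coordinate.\<close>

definition weight :: "nat \<Rightarrow> nat \<Rightarrow> nat \<Rightarrow> real" where
  "weight l i j =
    (if l = 0 then 1
     else if l = 1 then kink (value_at i) knot j
     else if i < d then
       (if j = i then 1 else if l - 1 = m * i \<and> j = d then 2 / real n
        else if l - 1 = m * i \<and> j = d + 1 then - 4 / real n else 0)
     else if j = d then 2 else if j = d + 1 then - 4 else 0)"

definition bias :: "nat \<Rightarrow> nat \<Rightarrow> real" where
  "bias l i =
    (if l = 0 then - knot i
     else (if l = 1 then value_at i 0 else 0) - (if i = d + 1 then 1 / 2 else 0))"

definition curve_net :: "layer list" where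
  "curve_net = net (steps + 2) width weight bias"

definition pre :: "real \<Rightarrow> nat \<Rightarrow> nat \<Rightarrow> real" where
  "pre t = preact width weight bias (\<lambda>_. t)"

section \<open>Knots and the partition of the unit interval\<close>

lemma cells_pos: "0 < n ^ d"
  using n by simp

lemma enum_mem: "i < n ^ d \<Longrightarrow> e i \<in> grid_index d n"
  using enum by (auto simp: bij_betw_def)

lemma mass_pos: "i < n ^ d \<Longrightarrow> 0 < mass i"
  using enum_mem[of i] weights n by (auto simp: mass_def admissible_weights_def)

lemma sum_mass: "(\<Sum>i<n ^ d. mass i) = 1"
proof -
  have "(\<Sum>i<n ^ d. w (e i)) = (\<Sum>k\<in>grid_index d n. w k)"
    by (rule sum.reindex_bij_betw[OF enum])
  then show ?thesis using weights n
    by (simp add: mass_def sum_divide_distrib[symmetric] admissible_weights_def)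
qed

lemma knot_even: "knot (2 * i) = (\<Sum>i'<i. mass i')"
  by (simp add: knot_def)

lemma knot_odd: "knot (Suc (2 * i)) = knot (2 * i) + (1 - \<epsilon>) * mass i"
  by (simp add: knot_def)

lemma knot_even_Suc: "knot (2 * Suc i) = knot (2 * i) + mass i"
  by (simp add: knot_def)

lemma knot_less: "r < 2 * n ^ d \<Longrightarrow> knot r < knot (Suc r)"
proof (cases "even r")
  case True
  moreover assume "r < 2 * n ^ d"
  ultimately obtain i where "r = 2 * i" "i < n ^ d" by (auto elim!: evenE)
  then show ?thesis using knot_odd mass_pos eps by simp
next
  case False
  moreover assume "r < 2 * n ^ d"
  ultimately obtain i where i: "r = Suc (2 * i)" "i < n ^ d" by (auto elim!: oddE)
  \<comment> \<open>The transition intervals are nondegenerate because \<open>\<epsilon>\<close> is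
    positive.\<close>
  have "knot (Suc r) - knot r = \<epsilon> * mass i"
    using knot_odd[of i] knot_even_Suc[of i] i by (simp add: algebra_simps)
  moreover have "0 < \<epsilon> * mass i" using mass_pos[OF i(2)] eps by simp
  ultimately show ?thesis by linarith
qed

lemma knot_even_mono: "i \<le> i' \<Longrightarrow> i' \<le> n ^ d \<Longrightarrow> knot (2 * i) \<le> knot (2 * i')"
  unfolding knot_even using mass_pos by (intro sum_mono2) (auto intro!: less_imp_le)

lemma knot_ends: "knot 0 = 0" "knot (2 * n ^ d) = 1"
  using sum_mass by (simp_all add: knot_def)

lemma knot_interval:
  assumes "0 \<le> t" "t \<le> 1"
  obtains r where "r < 2 * n ^ d" "knot r \<le> t" "t \<le> knot (Suc r)"
proof -
  define r where "r = (LEAST r. t \<le> knot (Suc r))"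
  have ex: "t \<le> knot (Suc (2 * n ^ d - 1))" using assms knot_ends cells_pos by simp
  have 1: "t \<le> knot (Suc r)" unfolding r_def using ex by (rule LeastI)
  have "r \<le> 2 * n ^ d - 1" unfolding r_def using ex by (rule Least_le)
  then have 2: "r < 2 * n ^ d" using cells_pos by linarith
  have "knot r \<le> t"
  proof (cases r)
    case (Suc r')
    then have "\<not> t \<le> knot (Suc r')" using not_less_Least[of r' "\<lambda>r. t \<le> knot (Suc r)"] by (simp add: r_def)
    then show ?thesis using Suc by simp
  qed (use assms knot_ends in simp)
  with 1 2 that show thesis by blast
qed

text \<open>The truncation in \<open>corner\<close> keeps the cube index valid for every
  \<open>r\<close>. The upper bound leaves room \<open>1 / n\<close> for the scaled phase.\<close>

lemma corner_range:
  assumes "i < d"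
  shows "0 \<le> corner i r" "corner i r \<le> 1 - 1 / real n"
proof -
  have "min (r div 2) (n ^ d - 1) < n ^ d" using cells_pos by linarith
  then have "e (min (r div 2) (n ^ d - 1)) i < n"
    using enum_mem assms by (auto simp: grid_index_def PiE_iff)
  then show "corner i r \<le> 1 - 1 / real n" using n by (simp add: corner_def field_simps)
qed (simp add: corner_def)

section \<open>The function computed by the network\<close>

definition interp :: "(nat \<Rightarrow> real) \<Rightarrow> nat \<Rightarrow> real \<Rightarrow> real" where
  "interp y r t = y r + (y (Suc r) - y r) * ((t - knot r) / (knot (Suc r) - knot r))"

lemma interp_range:
  assumes "r < 2 * n ^ d" "knot r \<le> t" "t \<le> knot (Suc r)" "\<And>r. a \<le> y r \<and> y r \<le> b"
  shows "a \<le> interp y r t" "interp y r t \<le> b"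
proof -
  define \<theta> where "\<theta> = (t - knot r) / (knot (Suc r) - knot r)"
  have \<theta>: "0 \<le> \<theta>" "\<theta> \<le> 1" using knot_less[OF assms(1)] assms(2,3) by (auto simp: \<theta>_def)
  have i: "interp y r t = (1 - \<theta>) * y r + \<theta> * y (Suc r)"
    by (simp add: interp_def \<theta>_def[symmetric] algebra_simps)
  have "(1 - \<theta>) * a + \<theta> * a \<le> interp y r t" "interp y r t \<le> (1 - \<theta>) * b + \<theta> * b"
    unfolding i using \<theta> assms(4) by (intro add_mono mult_left_mono; simp)+
  then show "a \<le> interp y r t" "interp y r t \<le> b" by (simp_all add: algebra_simps)
qed

lemma phase_range: "0 \<le> phase r \<and> phase r \<le> 1"
  by (auto simp: phase_def)

lemma pre_Suc_Suc:
  assumes "Suc l \<le> steps"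
  shows "pre t (Suc (Suc l)) i
    = (\<Sum>j<d + 2. weight (Suc (Suc l)) i j * max (pre t (Suc l) j) 0) + bias (Suc (Suc l)) i"
  using assms by (simp add: pre_def width_def)

text \<open>The invariant of the shared layers: a coordinate keeps its corner and has received its
  phase once layer number \<open>m * i\<close> is passed, while the last two entries carry the
  current tent iterate. Coordinates are nonnegative, so rectification leaves them unchanged.\<close>

lemma pre_eq:
  assumes r: "r < 2 * n ^ d" "knot r \<le> t" "t \<le> knot (Suc r)"
    and "l \<le> steps" "i < d + 2"
  shows "pre t (Suc l) i =
    (if i < d
     then interp (corner i) r t + (if m * i \<le> l then (tent ^^ (m * i)) (interp phase r t) / real n else 0)
     else (tent ^^ l) (interp phase r t) - (if i = d + 1 then 1 / 2 else 0))"
  using assms(4,5)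
proof (induction l arbitrary: i)
  case 0
  have "pre t (Suc 0) i = (\<Sum>j<2 * n ^ d. kink (value_at i) knot j * max (t - knot j) 0) + bias 1 i"
    by (simp add: pre_def width_def weight_def bias_def)
  also have "\<dots> = interp (value_at i) r t - (if i = d + 1 then 1 / 2 else 0)"
    using relu_interpolation[OF knot_less r, of "value_at i"] by (simp add: bias_def interp_def)
  \<comment> \<open>Interpolation is linear in the nodal values, so corner and phase
    separate.\<close>
  also have "interp (value_at i) r t = (if i < d
      then interp (corner i) r t + (if i = 0 then interp phase r t / real n else 0)
      else interp phase r t)"
    using n knot_less[OF r(1)] by (simp add: interp_def value_at_def divide_simps) (simp add: algebra_simps)
  \<comment> \<open>Since \<open>m \<ge> 1\<close>, the condition \<open>m * i \<le> 0\<close>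
    singles out \<open>i = 0\<close>.\<close>
  finally show ?case using m by auto
next
  case (Suc l)
  define u where "u = interp phase r t"
  have u: "0 \<le> u" "u \<le> 1" unfolding u_def
    using interp_range[OF r, of 0 phase 1] phase_range by auto
  have pos: "0 \<le> (tent ^^ k) u" for k using funpow_tent_range[OF u] by blast
  have IH: "pre t (Suc l) i = (if i < d
     then interp (corner i) r t + (if m * i \<le> l then (tent ^^ (m * i)) u / real n else 0)
     else (tent ^^ l) u - (if i = d + 1 then 1 / 2 else 0))" if "i < d + 2" for i
    unfolding u_def using Suc.prems that by (intro Suc.IH) auto
  \<comment> \<open>The two phase entries are exactly the two rectifier arguments of
    \<open>tent\<close>.\<close>
  have tent: "(tent ^^ Suc l) u = 2 * max (pre t (Suc l) d) 0 - 4 * max (pre t (Suc l) (d + 1)) 0"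
    by (simp add: IH tent_def)
  define S where "S i = (\<Sum>j<d. weight (Suc (Suc l)) i j * max (pre t (Suc l) j) 0)" for i
  have split: "pre t (Suc (Suc l)) i = S i
      + weight (Suc (Suc l)) i d * max (pre t (Suc l) d) 0
      + weight (Suc (Suc l)) i (d + 1) * max (pre t (Suc l) (d + 1)) 0 + bias (Suc (Suc l)) i"
    using Suc.prems by (simp add: pre_Suc_Suc S_def)
  show ?case
  proof (cases "i < d")
    case True
    have "S i = (\<Sum>j<d. if j = i then max (pre t (Suc l) i) 0 else 0)"
      unfolding S_def using True by (intro sum.cong refl) (auto simp: weight_def)
    also have "\<dots> = max (pre t (Suc l) i) 0" using True by simp
    also have "\<dots> = pre t (Suc l) i"
      using IH[of i] True pos interp_range(1)[OF r, of 0 "corner i" "1 - 1 / real n"] corner_range[OF True]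
      by simp
    finally have S: "S i = pre t (Suc l) i" .
    have "weight (Suc (Suc l)) i d * max (pre t (Suc l) d) 0
        + weight (Suc (Suc l)) i (d + 1) * max (pre t (Suc l) (d + 1)) 0
        = (if Suc l = m * i then (tent ^^ Suc l) u / real n else 0)"
      using True unfolding tent by (simp add: weight_def diff_divide_distrib)
    then show ?thesis
      using True IH[of i] S split unfolding u_def[symmetric] by (auto simp: bias_def)
  next
    case False
    then have "S i = 0" unfolding S_def by (intro sum.neutral) (auto simp: weight_def)
    then show ?thesis using False split unfolding u_def[symmetric] tent
      by (simp add: weight_def bias_def)
  qed
qed

definition curve :: "real \<Rightarrow> nat \<Rightarrow> real" where "curve = net_fun_1d d curve_net"

lemma realize_curve_net: "realize curve_net [t] = map (pre t (Suc steps)) [0..<d]"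
  using realize_net[of steps width weight bias "\<lambda>_. t"]
  by (simp add: curve_net_def pre_def width_def)

lemma curve_eq:
  assumes r: "r < 2 * n ^ d" "knot r \<le> t" "t \<le> knot (Suc r)" and i: "i < d"
  shows "curve t i = interp (corner i) r t + (tent ^^ (m * i)) (interp phase r t) / real n"
proof -
  \<comment> \<open>The number \<open>steps\<close> is just large enough for the last coordinate to
    receive its phase.\<close>
  have "i \<le> d - 1" using i by linarith
  then have "m * i \<le> steps" by (simp add: steps_def)
  then show ?thesis using i pre_eq[OF r order_refl, of i]
    by (simp add: curve_def net_fun_1d_def realize_curve_net)
qed

lemma curve_measurable: "curve \<in> measurable borel (Rd d)"
proof -
  have "(\<lambda>t. preact width weight bias (\<lambda>_. t) l i) \<in> borel_measurable borel" for l i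
    by (induction l arbitrary: i) simp_all
  then have "(\<lambda>t. \<lambda>i\<in>{..<d}. pre t (Suc steps) i) \<in> measurable borel (Rd d)"
    unfolding Rd_def pre_def by (intro measurable_restrict) simp
  moreover have "curve = (\<lambda>t. \<lambda>i\<in>{..<d}. pre t (Suc steps) i)"
    by (auto simp: curve_def net_fun_1d_def realize_curve_net fun_eq_iff)
  ultimately show ?thesis by simp
qed

text \<open>The corner part is at most \<open>1 - 1 / n\<close> and the phase part at most
  \<open>1 / n\<close>. This covers the transitions as well, so the curve never leaves the unit
  cube.\<close>

lemma curve_range:
  assumes "0 \<le> t" "t \<le> 1" "i < d"
  shows "0 \<le> curve t i" "curve t i \<le> 1"
proof -
  obtain r where r: "r < 2 * n ^ d" "knot r \<le> t" "t \<le> knot (Suc r)"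
    using knot_interval assms by blast
  have u: "0 \<le> interp phase r t" "interp phase r t \<le> 1"
    using interp_range[OF r, of 0 phase 1] phase_range by auto
  have c: "0 \<le> interp (corner i) r t" "interp (corner i) r t \<le> 1 - 1 / real n"
    using interp_range[OF r, of 0 "corner i" "1 - 1 / real n"] corner_range[OF assms(3)] by auto
  note T = funpow_tent_range[OF u, of "m * i"]
  have "(tent ^^ (m * i)) (interp phase r t) / real n \<le> 1 / real n"
    using T by (intro divide_right_mono) auto
  then show "0 \<le> curve t i" "curve t i \<le> 1"
    using c T unfolding curve_eq[OF r assms(3)] by auto
qed

section \<open>Input intervals assigned to the fine cubes\<close>

definition coarse :: "(nat \<Rightarrow> nat) \<Rightarrow> nat \<Rightarrow> nat" where
  "coarse \<kappa> = (\<lambda>j\<in>{..<d}. \<kappa> j div 2 ^ m)"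

definition cell_index :: "(nat \<Rightarrow> nat) \<Rightarrow> nat" where
  "cell_index \<kappa> = the_inv_into {..<n ^ d} e (coarse \<kappa>)"

definition fine_index :: "(nat \<Rightarrow> nat) \<Rightarrow> nat" where
  "fine_index \<kappa> = snake (2 ^ m) d (\<lambda>j. \<kappa> j mod 2 ^ m)"

text \<open>The inputs reserved for the fine cube \<open>\<kappa>\<close>: the traversal interval of
  its coarse cube is cut into \<open>(2 ^ m) ^ d\<close> equal parts, and the part at the snake
  position of the fine digits is taken.\<close>

definition piece :: "(nat \<Rightarrow> nat) \<Rightarrow> real set" where
  "piece \<kappa> = (let i = cell_index \<kappa>; c = real (fine_index \<kappa>); L = (1 - \<epsilon>) * mass i / (2 ^ m) ^ d
     in {knot (2 * i) + L * c ..< knot (2 * i) + L * (c + 1)})"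

lemma cell_index:
  assumes "\<kappa> \<in> grid_index d (n * 2 ^ m)"
  shows "cell_index \<kappa> < n ^ d" "e (cell_index \<kappa>) = coarse \<kappa>"
proof -
  have "coarse \<kappa> \<in> e ` {..<n ^ d}"
    using coarse_index[OF assms] enum by (simp add: coarse_def bij_betw_def)
  moreover have "inj_on e {..<n ^ d}" using enum by (simp add: bij_betw_def)
  ultimately show "cell_index \<kappa> < n ^ d" "e (cell_index \<kappa>) = coarse \<kappa>"
    unfolding cell_index_def using the_inv_into_into[of e "{..<n ^ d}" "coarse \<kappa>" "{..<n ^ d}"]
    by (auto intro!: f_the_inv_into_f)
qed

lemma fine_index_less: "fine_index \<kappa> < (2 ^ m) ^ d"
  unfolding fine_index_def by (intro snake_less) simp

text \<open>Between the knots \<open>2 * i\<close> and \<open>2 * i + 1\<close> the quotient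
  \<open>\<theta> t\<close> is the interpolated phase, so membership takes the form required by
  \<open>funpow_tent_snake\<close>.\<close>

lemma mem_piece_iff:
  assumes "\<kappa> \<in> grid_index d (n * 2 ^ m)"
  defines "i \<equiv> cell_index \<kappa>"
  defines "\<theta> \<equiv> \<lambda>t. (t - knot (2 * i)) / ((1 - \<epsilon>) * mass i)"
  shows "t \<in> piece \<kappa> \<longleftrightarrow> real (fine_index \<kappa>) / (2 ^ m) ^ d \<le> \<theta> t
      \<and> \<theta> t < (real (fine_index \<kappa>) + 1) / (2 ^ m) ^ d"
proof -
  have "0 < (1 - \<epsilon>) * mass i" using mass_pos cell_index(1)[OF assms(1)] eps by (simp add: i_def)
  then show ?thesis
    unfolding piece_def Let_def i_def[symmetric] \<theta>_def by (simp add: field_simps)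
qed

lemma piece_in_interval:
  assumes "\<kappa> \<in> grid_index d (n * 2 ^ m)" "t \<in> piece \<kappa>"
  shows "knot (2 * cell_index \<kappa>) \<le> t" "t < knot (Suc (2 * cell_index \<kappa>))"
proof -
  define i where "i = cell_index \<kappa>"
  define \<theta> where "\<theta> = (t - knot (2 * i)) / ((1 - \<epsilon>) * mass i)"
  have q: "0 < (1 - \<epsilon>) * mass i" using mass_pos cell_index(1)[OF assms(1)] eps by (simp add: i_def)
  have "real (fine_index \<kappa>) + 1 \<le> (2 ^ m) ^ d"
    using fine_index_less[of \<kappa>] of_nat_le_iff[of "fine_index \<kappa> + 1" "(2 ^ m) ^ d", where 'a = real] by simp
  then have "(real (fine_index \<kappa>) + 1) / (2 ^ m) ^ d \<le> 1" by simp
  moreover have "0 \<le> real (fine_index \<kappa>) / (2 ^ m) ^ d" by simp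
  ultimately have "0 \<le> \<theta>" "\<theta> < 1"
    using assms(2) unfolding mem_piece_iff[OF assms(1)] \<theta>_def i_def by linarith+
  then show "knot (2 * cell_index \<kappa>) \<le> t" "t < knot (Suc (2 * cell_index \<kappa>))"
    using q unfolding knot_odd i_def[symmetric] by (auto simp: \<theta>_def zero_le_divide_iff)
qed

text \<open>Distinct coarse cubes own separated traversal intervals. Within one coarse cube, a
  common point forces equal snake positions, and \<open>snake_inject\<close> recovers the
  digits.\<close>

lemma disjoint_piece: "disjoint_family_on piece (grid_index d (n * 2 ^ m))"
  unfolding disjoint_family_on_def
proof (intro ballI impI)
  fix \<kappa> \<kappa>' assume \<kappa>: "\<kappa> \<in> grid_index d (n * 2 ^ m)" and \<kappa>': "\<kappa>' \<in> grid_index d (n * 2 ^ m)" and "\<kappa> \<noteq> \<kappa>'"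
  have *: "cell_index \<kappa> \<le> cell_index \<kappa>'"
    if "t \<in> piece \<kappa>" "t \<in> piece \<kappa>'" "\<kappa> \<in> grid_index d (n * 2 ^ m)" "\<kappa>' \<in> grid_index d (n * 2 ^ m)" for t \<kappa> \<kappa>'
  proof (rule ccontr)
    assume "\<not> cell_index \<kappa> \<le> cell_index \<kappa>'"
    then have "knot (2 * Suc (cell_index \<kappa>')) \<le> knot (2 * cell_index \<kappa>)"
      using cell_index(1)[OF that(3)] by (intro knot_even_mono) auto
    moreover have "knot (Suc (2 * cell_index \<kappa>')) < knot (2 * Suc (cell_index \<kappa>'))"
      using knot_less[of "Suc (2 * cell_index \<kappa>')"] cell_index(1)[OF that(4)] by simp
    ultimately show False
      using piece_in_interval[OF that(3,1)] piece_in_interval[OF that(4,2)] by linarith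
  qed
  show "piece \<kappa> \<inter> piece \<kappa>' = {}"
  proof (rule ccontr)
    assume "piece \<kappa> \<inter> piece \<kappa>' \<noteq> {}"
    then obtain t where t: "t \<in> piece \<kappa>" "t \<in> piece \<kappa>'" by auto
    have i: "cell_index \<kappa> = cell_index \<kappa>'"
      using *[OF t \<kappa> \<kappa>'] *[OF t(2,1) \<kappa>' \<kappa>] by simp
    let ?C = "(2 ^ m) ^ d :: real"
    \<comment> \<open>Two half-open unit intervals with integer left ends that meet are
      equal.\<close>
    have "real (fine_index \<kappa>) / ?C < (real (fine_index \<kappa>') + 1) / ?C"
      "real (fine_index \<kappa>') / ?C < (real (fine_index \<kappa>) + 1) / ?C"
      using t mem_piece_iff[OF \<kappa>] mem_piece_iff[OF \<kappa>'] i by force+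
    then have "fine_index \<kappa> = fine_index \<kappa>'" by (simp add: divide_less_cancel)
    then have mod: "\<kappa> j mod 2 ^ m = \<kappa>' j mod 2 ^ m" if "j < d" for j
      using that snake_inject[of "2 ^ m" d "\<lambda>j. \<kappa> j mod 2 ^ m" "\<lambda>j. \<kappa>' j mod 2 ^ m" j]
      by (simp add: fine_index_def)
    have co: "coarse \<kappa> = coarse \<kappa>'" using i cell_index(2)[OF \<kappa>] cell_index(2)[OF \<kappa>'] by simp
    have div: "\<kappa> j div 2 ^ m = \<kappa>' j div 2 ^ m" if "j < d" for j
      using that fun_cong[OF co, of j] by (simp add: coarse_def)
    have "\<kappa> j = \<kappa>' j" if "j < d" for j
      using mod[OF that] div[OF that] by (metis div_mult_mod_eq)
    then have "\<kappa> = \<kappa>'" using \<kappa> \<kappa>' by (intro PiE_ext) (auto simp: grid_index_def)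
    with \<open>\<kappa> \<noteq> \<kappa>'\<close> show False by simp
  qed
qed

lemma piece_in_unit:
  assumes "\<kappa> \<in> grid_index d (n * 2 ^ m)"
  shows "piece \<kappa> \<subseteq> {0..1}"
proof
  fix t assume "t \<in> piece \<kappa>"
  note t = piece_in_interval[OF assms this]
  have i: "cell_index \<kappa> < n ^ d" by (rule cell_index[OF assms])
  have "knot (2 * 0) \<le> knot (2 * cell_index \<kappa>)" "knot (2 * Suc (cell_index \<kappa>)) \<le> knot (2 * n ^ d)"
    using i by (intro knot_even_mono; simp)+
  moreover have "knot (Suc (2 * cell_index \<kappa>)) < knot (2 * Suc (cell_index \<kappa>))"
    using knot_less[of "Suc (2 * cell_index \<kappa>)"] i by simp
  ultimately show "t \<in> {0..1}" using t knot_ends by simp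
qed

text \<open>The value is \<open>1 - \<epsilon>\<close> times the mass of the fine cube, as
  \<open>wasserstein1_le_cells\<close> demands.\<close>

lemma emeasure_piece:
  assumes "\<kappa> \<in> grid_index d (n * 2 ^ m)"
  shows "emeasure lborel (piece \<kappa>) = ennreal ((1 - \<epsilon>) * (w (coarse \<kappa>) / real (n * 2 ^ m) ^ d))"
proof -
  have i: "cell_index \<kappa> < n ^ d" "e (cell_index \<kappa>) = coarse \<kappa>" by (rule cell_index[OF assms])+
  define L where "L = (1 - \<epsilon>) * mass (cell_index \<kappa>) / (2 ^ m) ^ d"
  have "0 \<le> L" using mass_pos[OF i(1)] eps by (simp add: L_def)
  then have "emeasure lborel (piece \<kappa>) = ennreal L"
    unfolding piece_def Let_def L_def[symmetric] by (subst emeasure_lborel_Ico) (auto simp: algebra_simps)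
  also have "L = (1 - \<epsilon>) * (w (coarse \<kappa>) / real (n * 2 ^ m) ^ d)"
    by (simp add: L_def mass_def i(2) power_mult_distrib)
  finally show ?thesis .
qed

section \<open>Distance estimates and the Wasserstein bound\<close>

lemma eucl_dist_le:
  assumes "\<And>j. j < d \<Longrightarrow> \<bar>x j - y j\<bar> \<le> \<delta>" "0 \<le> \<delta>"
  shows "eucl_dist d x y \<le> sqrt (real d) * \<delta>"
proof -
  have "(\<Sum>i<d. (x i - y i)\<^sup>2) \<le> (\<Sum>i<d. \<delta>\<^sup>2)"
    using assms by (intro sum_mono) (simp add: abs_le_square_iff[symmetric])
  then have "eucl_dist d x y \<le> sqrt (real d * \<delta>\<^sup>2)"
    unfolding eucl_dist_def by (intro real_sqrt_le_mono) simp
  then show ?thesis using assms(2) by (simp add: real_sqrt_mult)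
qed

text \<open>Both points lie in the closure of the fine cube \<open>\<kappa>\<close>: the corner
  supplies the coarse digits and the tent iterates supply the fine ones.\<close>

lemma curve_near:
  assumes \<kappa>: "\<kappa> \<in> grid_index d (n * 2 ^ m)" and t: "t \<in> piece \<kappa>" and y: "y \<in> hcube d (n * 2 ^ m) \<kappa>"
  shows "eucl_dist d (curve t) y \<le> sqrt (real d) * (1 / (real n * 2 ^ m))"
proof (rule eucl_dist_le)
  fix j assume j: "j < d"
  define i where "i = cell_index \<kappa>"
  have i: "i < n ^ d" "e i = coarse \<kappa>" using cell_index[OF \<kappa>] by (auto simp: i_def)
  have r: "2 * i < 2 * n ^ d" "knot (2 * i) \<le> t" "t \<le> knot (Suc (2 * i))"
    using i piece_in_interval[OF \<kappa> t] by (auto simp: i_def)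
  define \<theta> where "\<theta> = (t - knot (2 * i)) / ((1 - \<epsilon>) * mass i)"
  have ph: "interp phase (2 * i) t = \<theta>"
    by (simp add: interp_def phase_def \<theta>_def knot_odd)
  \<comment> \<open>Both knots \<open>2 * i\<close> and \<open>2 * i + 1\<close> belong to the same
    cube, so the corner is constant here; the truncation is inactive because
    \<open>i < n ^ d\<close>.\<close>
  have co: "interp (corner j) (2 * i) t = real (\<kappa> j div 2 ^ m) / real n"
    using i j by (simp add: interp_def corner_def min_absorb1 coarse_def)
  have cv: "curve t j = real (\<kappa> j div 2 ^ m) / real n + (tent ^^ (m * j)) \<theta> / real n"
    using curve_eq[OF r j] ph co by simp
  have "real (\<kappa> j mod 2 ^ m) / 2 ^ m \<le> (tent ^^ (m * j)) \<theta> \<and>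
      (tent ^^ (m * j)) \<theta> \<le> (real (\<kappa> j mod 2 ^ m) + 1) / 2 ^ m"
    using t j unfolding mem_piece_iff[OF \<kappa>] \<theta>_def i_def fine_index_def
    by (intro funpow_tent_snake[of d "\<lambda>j. \<kappa> j mod 2 ^ m"]) auto
  then have T: "real (\<kappa> j mod 2 ^ m) \<le> (tent ^^ (m * j)) \<theta> * 2 ^ m"
      "(tent ^^ (m * j)) \<theta> * 2 ^ m \<le> real (\<kappa> j mod 2 ^ m) + 1"
    by (simp_all add: divide_le_eq le_divide_eq)
  have "real (\<kappa> j) = real (\<kappa> j div 2 ^ m * 2 ^ m + \<kappa> j mod 2 ^ m)" by (simp only: div_mult_mod_eq)
  then have \<kappa>j: "real (\<kappa> j) = real (\<kappa> j div 2 ^ m) * 2 ^ m + real (\<kappa> j mod 2 ^ m)" by simp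
  have "curve t j = (real (\<kappa> j div 2 ^ m) * 2 ^ m + (tent ^^ (m * j)) \<theta> * 2 ^ m) / (real n * 2 ^ m)"
    using n unfolding cv by (simp add: field_simps)
  then have "real (\<kappa> j) / (real n * 2 ^ m) \<le> curve t j" "curve t j \<le> (real (\<kappa> j) + 1) / (real n * 2 ^ m)"
    using T n unfolding \<kappa>j by (auto intro!: divide_right_mono)
  moreover have "real (\<kappa> j) / (real n * 2 ^ m) \<le> y j" "y j \<le> (real (\<kappa> j) + 1) / (real n * 2 ^ m)"
    using y j by (auto simp: hcube_def PiE_iff less_imp_le)
  ultimately show "\<bar>curve t j - y j\<bar> \<le> 1 / (real n * 2 ^ m)"
    by (simp add: add_divide_distrib abs_le_iff)
qed simp

lemma curve_far:
  assumes \<kappa>: "\<kappa> \<in> grid_index d (n * 2 ^ m)" and t: "0 \<le> t" "t \<le> 1" and y: "y \<in> hcube d (n * 2 ^ m) \<kappa>"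
  shows "eucl_dist d (curve t) y \<le> sqrt (real d)"
proof -
  have "eucl_dist d (curve t) y \<le> sqrt (real d) * 1"
  proof (rule eucl_dist_le)
    fix j assume j: "j < d"
    have b: "real (\<kappa> j) / real (n * 2 ^ m) \<le> y j" "y j < (real (\<kappa> j) + 1) / real (n * 2 ^ m)"
      using y j by (auto simp: hcube_def PiE_iff)
    have "\<kappa> j < n * 2 ^ m" using \<kappa> j by (auto simp: grid_index_def PiE_iff)
    then have "real (\<kappa> j) + 1 \<le> real (n * 2 ^ m)"
      using of_nat_le_iff[of "\<kappa> j + 1" "n * 2 ^ m", where 'a = real] by simp
    then have "(real (\<kappa> j) + 1) / real (n * 2 ^ m) \<le> 1" using n by simp
    moreover have "0 \<le> real (\<kappa> j) / real (n * 2 ^ m)" by simp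
    ultimately have "0 \<le> y j" "y j \<le> 1" using b by linarith+
    then show "\<bar>curve t j - y j\<bar> \<le> 1" using curve_range[OF t j] by (simp add: abs_le_iff)
  qed simp
  then show ?thesis by simp
qed

lemma wasserstein1_curve_net:
  "wasserstein1 d (pushforward_uniform d curve_net) (grid_measure d n w)
    \<le> ennreal (sqrt (real d) * (1 / (real n * 2 ^ m)) + \<epsilon> * sqrt (real d))"
proof -
  let ?P = "uniform_measure lborel {0..1::real}" and ?N = "n * 2 ^ m"
  let ?I = "grid_index d ?N"
  have n0: "0 < n" "0 < (2::nat) ^ m" using n by auto
  interpret P: prob_space ?P by (rule prob_space_uniform_measure) auto
  interpret N: prob_space "grid_measure d n w" by (rule prob_space_grid_measure[OF n0(1) weights])
  have wpos: "0 < w (coarse \<kappa>) / real ?N ^ d" if "\<kappa> \<in> ?I" for \<kappa>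
    using coarse_index[OF that] weights n by (auto simp: coarse_def admissible_weights_def)
  have Q: "measure (grid_measure d n w) (hcube d ?N \<kappa>) = w (coarse \<kappa>) / real ?N ^ d" if "\<kappa> \<in> ?I" for \<kappa>
    using emeasure_grid_measure_hcube[OF n0 weights that] wpos[OF that]
    unfolding measure_def by (simp add: coarse_def)
  have G: "measure ?P (piece \<kappa>) = (1 - \<epsilon>) * (w (coarse \<kappa>) / real ?N ^ d)" if "\<kappa> \<in> ?I" for \<kappa>
  proof -
    have "piece \<kappa> \<in> sets lborel" by (simp add: piece_def Let_def)
    then have "emeasure ?P (piece \<kappa>) = emeasure lborel (piece \<kappa>)"
      using piece_in_unit[OF that] by (simp add: Int_absorb1 divide_ennreal_def)
    moreover have "0 \<le> (1 - \<epsilon>) * (w (coarse \<kappa>) / real ?N ^ d)"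
      using wpos[OF that] eps by (intro mult_nonneg_nonneg) auto
    ultimately show ?thesis using emeasure_piece[OF that]
      unfolding measure_def by (simp only: enn2real_ennreal)
  qed
  have "wasserstein1 d (distr ?P (Rd d) curve) (grid_measure d n w)
    \<le> ennreal (sqrt (real d) * (1 / (real n * 2 ^ m)) + \<epsilon> * sqrt (real d))"
  \<comment> \<open>The near distance is the diameter of a fine cube, the far distance that of the
    unit cube.\<close>
  proof (rule wasserstein1_le_cells[where I = ?I and G = piece and Q = "hcube d ?N"])
    show "curve \<in> measurable ?P (Rd d)" using curve_measurable by simp
    show "AE t in ?P. \<forall>\<kappa>\<in>?I. \<forall>y\<in>hcube d ?N \<kappa>. eucl_dist d (curve t) y \<le> sqrt (real d)"
      by (rule AE_uniform_measureI) (auto intro!: curve_far)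
    show "AE y in grid_measure d n w. y \<in> (\<Union>\<kappa>\<in>?I. hcube d ?N \<kappa>)"
      by (rule AE_grid_measure_hcube[OF n0])
  qed (use P.prob_space_axioms N.prob_space_axioms eps n0 Q G wpos curve_near disjoint_piece disjoint_hcube in
      \<open>auto simp: grid_measure_def piece_def Let_def\<close>)
  then show ?thesis by (simp add: pushforward_uniform_def curve_def)
qed

section \<open>Size of the network\<close>

lemma curve_net_in_relu_nets: "curve_net \<in> relu_nets 1 d"
  using net_in_relu_nets[of "steps + 2" width weight bias] by (simp add: curve_net_def width_def)

lemma depth_curve_net: "depth curve_net = steps + 2"
  by (simp add: depth_def curve_net_def net_def)

lemma connectivity_curve_net:
  "connectivity curve_net \<le> 4 * n ^ d + (d + 2) * (2 * n ^ d + 1) + steps * (4 * (d + 2))"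
proof -
  define N where "N l = (if l = 0 then 1 else if l = 1 then 2 * n ^ d else 3)" for l :: nat
  have "card {j. j < width l \<and> weight l i j \<noteq> 0} \<le> N l" for l i
  proof -
    have "card {j. j < width l \<and> weight l i j \<noteq> 0} \<le> card {j. j < width l}"
      by (intro card_mono) auto
    moreover have "card {j. j < width l \<and> weight l i j \<noteq> 0} \<le> 3" if "2 \<le> l"
    proof -
      \<comment> \<open>A coordinate row reads its own entry and possibly the two phase entries; a
        phase row reads only the latter.\<close>
      have "card {j. j < width l \<and> weight l i j \<noteq> 0} \<le> card {i, d, d + 1}"
        using that by (intro card_mono) (auto simp: weight_def split: if_splits)
      also have "\<dots> \<le> 3" using card_length[of "[i, d, d + 1]"] by simp
      finally show ?thesis .
    qed
    ultimately show ?thesis by (auto simp: N_def width_def)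
  qed
  then have "connectivity curve_net \<le> (\<Sum>l<steps + 2. width (Suc l) * (N l + 1))"
    unfolding curve_net_def by (rule connectivity_net_le)
  also have "\<dots> = width 1 * (N 0 + 1) + (width 2 * (N 1 + 1)
      + (\<Sum>l<steps. width (Suc (Suc (Suc l))) * (N (Suc (Suc l)) + 1)))"
    by (simp add: sum.lessThan_Suc_shift numeral_2_eq_2 del: sum.lessThan_Suc)
  also have "\<dots> \<le> 4 * n ^ d + ((d + 2) * (2 * n ^ d + 1) + (\<Sum>l<steps. 4 * (d + 2)))"
    by (intro add_mono sum_mono) (auto simp: width_def N_def)
  finally show ?thesis by simp
qed

end

section \<open>Numerical bounds and conclusion\<close>

lemma size_bound:
  fixes d n s :: nat
  assumes "1 \<le> d" "1 \<le> n"
  shows "4 * n ^ d + (d + 2) * (2 * n ^ d + 1) + (d - 1) * (s + 3) * (4 * (d + 2))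
    \<le> 22 * 2 ^ d * (n ^ d + n ^ (d - 1) * s)"
proof -
  define T where "T = n ^ d + n ^ (d - 1) * s"
  obtain k where k: "d = Suc k" using assms(1) by (cases d) auto
  have "1 \<le> n ^ d" "1 * s \<le> n ^ (d - 1) * s" using assms(2) by (auto intro!: mult_right_mono)
  then have T: "n ^ d \<le> T" "1 \<le> T" "s + 1 \<le> T" unfolding T_def by linarith+
  \<comment> \<open>This is \<open>poly\<close> below for \<open>k = i + 2\<close>. The polynomial
    there more than doubles from \<open>k = 0\<close> to 1 and from 1 to 2, so the doubling
    induction starts only at \<open>k = 2\<close>.\<close>
  have tail: "12 * (i * i) + 87 * i + 139 \<le> 176 * 2 ^ i" for i :: nat
  proof (induction i)
    case (Suc i)
    have "12 * (Suc i * Suc i) + 87 * Suc i + 139 \<le> 2 * (12 * (i * i) + 87 * i + 139)"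
      by (simp add: algebra_simps)
    also have "\<dots> \<le> 2 * (176 * 2 ^ i)" using Suc.IH by (rule mult_left_mono) simp
    finally show ?case by simp
  qed simp
  have poly: "12 * (k * k) + 39 * k + 13 \<le> 44 * 2 ^ k"
  proof (cases "2 \<le> k")
    case True
    then obtain i where i: "k = 2 + i" using le_Suc_ex by blast
    have "12 * (k * k) + 39 * k + 13 = 12 * (i * i) + 87 * i + 139"
      unfolding i by (simp add: algebra_simps)
    also have "\<dots> \<le> 176 * 2 ^ i" by (rule tail)
    finally show ?thesis by (simp add: i)
  next
    case False
    then have "k = 0 \<or> k = 1" by linarith
    then show ?thesis by auto
  qed
  \<comment> \<open>Each factor is compared with \<open>T\<close>, using
    \<open>s + 3 \<le> 3 * T\<close> and \<open>1 \<le> T\<close>; only a polynomial in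
    \<open>d\<close> remains.\<close>
  have "4 * n ^ d + (d + 2) * (2 * n ^ d + 1) + (d - 1) * (s + 3) * (4 * (d + 2))
      \<le> 4 * T + (d + 2) * (2 * T + T) + (d - 1) * (3 * T) * (4 * (d + 2))"
    using T by (intro add_mono mult_mono) auto
  also have "\<dots> = (12 * (k * k) + 39 * k + 13) * T" by (simp add: k algebra_simps)
  also have "\<dots> \<le> 44 * 2 ^ k * T" using poly by (rule mult_right_mono) simp
  also have "\<dots> = 22 * 2 ^ d * T" by (simp add: k)
  finally show ?thesis by (simp only: T_def)
qed

theorem mainTheorem9:
  fixes d n s :: nat and w :: "(nat \<Rightarrow> nat) \<Rightarrow> real"
  assumes "d \<ge> 1" and "n \<ge> 1"
    and "admissible_weights d n w"
  shows "\<exists>\<Psi>\<in>relu_nets 1 d.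
           connectivity \<Psi> \<le> 22 * 2^d * (n^d + n^(d-1) * s) \<and>
           depth \<Psi> = (d - 1) * (s + 3) + 2 \<and>
           wasserstein1 d (pushforward_uniform d \<Psi>) (grid_measure d n w)
             \<le> ennreal (sqrt (real d) / (real n * 2^s))"
proof -
  obtain e where e: "bij_betw e {..<n ^ d} (grid_index d n)"
    using ex_bij_betw_nat_finite[OF finite_grid_index, of d n]
    by (auto simp: card_grid_index atLeast0LessThan)
  \<comment> \<open>Transitions may use half of the admissible error.\<close>
  define \<epsilon> where "\<epsilon> = 1 / (real n * 2 ^ s) / 2"
  have "1 * 1 \<le> real n * 2 ^ s" using assms(2) by (intro mult_mono) auto
  then have "1 / (real n * 2 ^ s) \<le> 1" by simp
  then have eps: "0 < \<epsilon>" "\<epsilon> < 1" using assms(2) by (simp_all add: \<epsilon>_def)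
  interpret grid_net d n "s + 3" w e \<epsilon>
    by unfold_locales (use assms e eps in auto)
  \<comment> \<open>The three extra tent steps per coordinate reduce the cell error to 1/8 of the
    target, for a total of 5/8.\<close>
  have "sqrt (real d) * (1 / (real n * 2 ^ (s + 3))) + \<epsilon> * sqrt (real d)
      = (1 / 8 + 1 / 2) * (sqrt (real d) / (real n * 2 ^ s))"
    by (simp add: \<epsilon>_def power_add algebra_simps)
  also have "\<dots> \<le> 1 * (sqrt (real d) / (real n * 2 ^ s))"
    by (intro mult_right_mono) auto
  finally have "wasserstein1 d (pushforward_uniform d curve_net) (grid_measure d n w)
      \<le> ennreal (sqrt (real d) / (real n * 2 ^ s))"
    using wasserstein1_curve_net by (auto intro: order_trans ennreal_leI)
  moreover have "connectivity curve_net \<le> 22 * 2 ^ d * (n ^ d + n ^ (d - 1) * s)"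
    using connectivity_curve_net size_bound[OF assms(1,2), of s] by (simp add: steps_def)
  moreover have "depth curve_net = (d - 1) * (s + 3) + 2"
    by (simp add: depth_curve_net steps_def)
  ultimately show ?thesis using curve_net_in_relu_nets by blast
qed

end
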